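(* Let $f:\mathbb{R}^d\to\mathbb{R}$ be continuous with a unique $x^*\in\mathbb{R}^d$ such that $f(x^* )=\min f=:\underline f$; assume there is $L_f>0$ with $|f(x)-f(y)|\le L_f(1+|x|+|y|)|x-y|$ for all $x,y\in\mathbb{R}^d$, and there are $c_\ell,c_u,M>0$ with $f(x)-\underline f\le c_u(|x|^2+1)$ for all $x\in\mathbb{R}^d$ and $c_\ell|x|^2\le f(x)-\underline f$ for $|x|\ge M$. Let $x_0\in\mathbb{R}^d$ be an arbitrary initial point, and let $\{x_k^{CH}\}_{k\in\mathbb N}$ be the solution to the Consensus Hopping scheme with initial datum $x_0$ and $\tilde\sigma=\tfrac{\delta}{\sqrt{2\lambda}}$. Furthermore, for $s>0$, let $\mu_t^{\alpha,s,\Delta t}$ be the mean of the solution $\varrho_t^{\alpha,s,\Delta t}$ to the Consensus Freezing scheme with the prescribed $s$ and initial data $\varrho_0=\mathcal N(x_0,\Sigma)$, where $\Sigma=\tfrac{\delta^2}{2\lambda}I_d$. Then, for large enough $\alpha$, $$|\mu_{t_k}^{\alpha,s,\Delta t}-x_k^{CH}|\le4R\,e^{-s\lambda\Delta t}\to0\quad\text{as }s\to\infty,\quad\forall k\in\mathbb N,$$ where $R>0$ is a uniform bound on $\mu_t^{\alpha,s,\Delta t}$, given by the global-in-time bounds recalled in the context, such that $x^*\in B_R(0)$. In particular, $$W_2\big(\varrho_{t_k}^{\alpha,s,\Delta t},\mathcal N(x_k^{CH},\Sigma)\big)\le4R\,e^{-s\lambda\Delta t}\to0\quad\text{as }s\to\infty,$$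 uniformly with respect to $k\in\mathbb N$.
   Context: For a probability measure $\rho$ on $\mathbb{R}^d$ and $\alpha>0$, the consensus point is $X^\alpha(\rho)=\frac{\int x e^{-\alpha f(x)}d\rho(x)}{\int e^{-\alpha f(x)}d\rho(x)}$. $W_2$ is the 2-Wasserstein distance, $B_R(0)$ the ball of radius $R$ centred at $0$; $\lambda,\delta,\Delta t>0$ are fixed and $B_t$ is a standard Brownian motion. Consensus Hopping scheme: $x_0^{CH}=x_0$, $x_k^{CH}=X^\alpha\big(\mathcal N(x_{k-1}^{CH},\tilde\sigma^2I_d)\big)$ for $k\ge1$. Consensus Freezing scheme: $dX_t=-s\lambda\big(X_t-X^\alpha(\varrho^{\alpha,s,\Delta t}_{t_i})\big)dt+\sqrt s\,\delta\,dB_t$ for $t\in[t_i,t_{i+1})$, $t_i=i\Delta t$, $\varrho^{\alpha,s,\Delta t}_t=\mathrm{Law}(X_t)$. When $\varrho_0=\mathcal N(x_0,\Sigma)$, one has $\varrho_t^{\alpha,s,\Delta t}=\mathcal N(\mu_t^{\alpha,s,\Delta t},\Sigma)$ for all $t$. Global-in-time bounds: for an integer $p\ge2$ and an initial measure with finite $p$-th moment, there exist $\alpha_0>0$ and $S>0$ such that for all $\alpha\ge\alpha_0$ the solution of the Consensus Freezing scheme satisfies $\mathbb E_{\varrho_t^{\alpha,s,\Delta t}}[|x|^q]\le S$ for all $t\ge0$ and all $q\in\mathbb N$ with $q\le p$, and $|X^\alpha(\varrho_t^{\alpha,s,\Delta t})|\le S$ for all $t\ge0$. *)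

theory Defs
  imports "HOL-Probability.Probability"
begin

text \<open>The Euclidean space \<open>\<real>\<^sup>d\<close> is an arbitrary type of class \<^class>\<open>euclidean_space\<close>; measures on it
  are measures on its Borel sets.\<close>

text \<open>The Gaussian measure \<open>N(m, \<sigma>\<^sup>2 I\<^sub>d)\<close>, for \<open>\<sigma> > 0\<close>. The second parameter is the standard
  deviation of each coordinate, not the variance.\<close>

definition gaussian :: "'a::euclidean_space \<Rightarrow> real \<Rightarrow> 'a measure" where
  "gaussian m \<sigma> = density lborel (\<lambda>x. ennreal (\<Prod>b\<in>Basis. normal_density (m \<bullet> b) \<sigma> (x \<bullet> b)))"

definition consensus_point :: "('a::euclidean_space \<Rightarrow> real) \<Rightarrow> real \<Rightarrow> 'a measure \<Rightarrow> 'a" where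
  "consensus_point f \<alpha> \<rho> =
     (\<integral>x. exp (- \<alpha> * f x) *\<^sub>R x \<partial>\<rho>) /\<^sub>R (\<integral>x. exp (- \<alpha> * f x) \<partial>\<rho>)"

definition couplings :: "'a::euclidean_space measure \<Rightarrow> 'a measure \<Rightarrow> ('a \<times> 'a) measure set" where
  "couplings \<mu> \<nu> = {\<pi>. sets \<pi> = sets borel \<and> distr \<pi> borel fst = \<mu> \<and> distr \<pi> borel snd = \<nu>}"

text \<open>The case distinction is the square root on \<^typ>\<open>ennreal\<close>: an infinite transport cost gives an
  infinite distance.\<close>

definition wasserstein2 :: "'a::euclidean_space measure \<Rightarrow> 'a measure \<Rightarrow> ennreal" where
  "wasserstein2 \<mu> \<nu> =
     (let c = (INF \<pi>\<in>couplings \<mu> \<nu>. \<integral>\<^sup>+p. ennreal ((dist (fst p) (snd p))\<^sup>2) \<partial>\<pi>)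
      in if c = \<top> then \<top> else ennreal (sqrt (enn2real c)))"

definition brownian_motion :: "'w measure \<Rightarrow> (real \<Rightarrow> 'w \<Rightarrow> 'a::euclidean_space) \<Rightarrow> bool" where
  "brownian_motion M B \<longleftrightarrow>
     prob_space M \<and>
     (\<forall>t\<ge>0. B t \<in> borel_measurable M) \<and>
     (AE \<omega> in M. B 0 \<omega> = 0) \<and>
     (AE \<omega> in M. continuous_on {0..} (\<lambda>t. B t \<omega>)) \<and>
     (\<forall>r\<ge>0. \<forall>t>r. distr M borel (\<lambda>\<omega>. B t \<omega> - B r \<omega>) = gaussian 0 (sqrt (t - r))) \<and>
     (\<forall>n (\<tau> :: nat \<Rightarrow> real). 0 \<le> \<tau> 0 \<and> mono \<tau> \<longrightarrow>
        prob_space.indep_vars M (\<lambda>_. borel) (\<lambda>i \<omega>. B (\<tau> (Suc i)) \<omega> - B (\<tau> i) \<omega>) {..<n})"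

abbreviation law :: "'w measure \<Rightarrow> (real \<Rightarrow> 'w \<Rightarrow> 'a::euclidean_space) \<Rightarrow> real \<Rightarrow> 'a measure" where
  "law M X t \<equiv> distr M borel (X t)"

definition mean :: "'a::euclidean_space measure \<Rightarrow> 'a" where
  "mean \<rho> = (\<integral>x. x \<partial>\<rho>)"

primrec consensus_hopping ::
    "('a::euclidean_space \<Rightarrow> real) \<Rightarrow> real \<Rightarrow> real \<Rightarrow> 'a \<Rightarrow> nat \<Rightarrow> 'a" where
  "consensus_hopping f \<alpha> \<sigma> x0 0 = x0"
| "consensus_hopping f \<alpha> \<sigma> x0 (Suc k) =
     consensus_point f \<alpha> (gaussian (consensus_hopping f \<alpha> \<sigma> x0 k) \<sigma>)"

text \<open>\<open>X\<close> solves, on the probability space \<open>M\<close> and driven by \<open>B\<close>, the equation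
  \<open>dX\<^sub>t = - s lam (X\<^sub>t - X\<^sup>\<alpha>(Law(X\<^bsub>t\<^sub>i\<^esub>))) dt + sqrt s \<delta> dB\<^sub>t\<close> on each \<open>[t\<^sub>i, t\<^sub>i\<^sub>+\<^sub>1)\<close> with
  \<open>t\<^sub>i = i \<Delta>t\<close>. The noise coefficient is constant, so the stochastic integral over \<open>[t\<^sub>i, t]\<close> is the
  increment of \<open>B\<close>, and the integral form of the equation is pathwise.
  As usual for a strong solution, the initial value is independent of the Brownian motion.\<close>

definition consensus_freezing_solution ::
    "('a::euclidean_space \<Rightarrow> real) \<Rightarrow> real \<Rightarrow> real \<Rightarrow> real \<Rightarrow> real \<Rightarrow> real \<Rightarrow> 'a measure \<Rightarrow>
      'w measure \<Rightarrow> (real \<Rightarrow> 'w \<Rightarrow> 'a) \<Rightarrow> (real \<Rightarrow> 'w \<Rightarrow> 'a) \<Rightarrow> bool" where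
  "consensus_freezing_solution f lam \<delta> \<Delta>t \<alpha> s \<rho>0 M B X \<longleftrightarrow>
     brownian_motion M B \<and>
     (\<forall>t\<ge>0. X t \<in> borel_measurable M) \<and>
     law M X 0 = \<rho>0 \<and>
     prob_space.indep_set M
       (sets (vimage_algebra (space M) (X 0) borel))
       (sets (vimage_algebra (space M) (\<lambda>\<omega>. \<lambda>t\<in>{0..}. B t \<omega>) (PiM {0..} (\<lambda>_. borel)))) \<and>
     (AE \<omega> in M.
        continuous_on {0..} (\<lambda>t. X t \<omega>) \<and>
        (\<forall>i::nat. \<forall>t\<in>{real i * \<Delta>t .. real (Suc i) * \<Delta>t}.
           X t \<omega> = X (real i * \<Delta>t) \<omega>
             - (s * lam) *\<^sub>R integral {real i * \<Delta>t .. t}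
                 (\<lambda>r. X r \<omega> - consensus_point f \<alpha> (law M X (real i * \<Delta>t)))
             + (sqrt s * \<delta>) *\<^sub>R (B t \<omega> - B (real i * \<Delta>t) \<omega>)))"

text \<open>\<open>R\<close> bounds the mean of the Consensus Freezing solution uniformly in time, in \<open>s > 0\<close> and in
  all large \<open>\<alpha>\<close>. The first argument only fixes the carrier type of the probability spaces.\<close>

definition uniform_mean_bound ::
    "'w itself \<Rightarrow> ('a::euclidean_space \<Rightarrow> real) \<Rightarrow> real \<Rightarrow> real \<Rightarrow> real \<Rightarrow> 'a measure \<Rightarrow> real \<Rightarrow> bool" where
  "uniform_mean_bound _ f lam \<delta> \<Delta>t \<rho>0 R \<longleftrightarrow>
     (\<exists>\<alpha>0>0. \<forall>\<alpha>\<ge>\<alpha>0. \<forall>s>0. \<forall>(M :: 'w measure) B X.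
        consensus_freezing_solution f lam \<delta> \<Delta>t \<alpha> s \<rho>0 M B X \<longrightarrow>
        (\<forall>t\<ge>0. norm (mean (law M X t)) \<le> R))"

end

theory Submission
  imports Defs
begin

text \<open>Let \<open>T m = X\<^sup>\<alpha>(N(m, \<sigma>\<^sup>2 I))\<close>. By the Laplace principle the measures proportional to \<open>exp (- \<alpha> f) N(m, \<sigma>\<^sup>2 I)\<close>
  concentrate at the minimiser as \<open>\<alpha> \<rightarrow> \<infinity>\<close>, uniformly for \<open>|m| \<le> R\<close>; hence for large \<open>\<alpha>\<close> the map \<open>T\<close> sends the
  ball of radius \<open>R\<close> into itself and contracts it by the factor \<open>1/2\<close>. The Freezing solution has law
  \<open>N(\<mu>\<^sub>t, \<sigma>\<^sup>2 I)\<close>, where on the grid, with \<open>q = exp (- s \<lambda> \<Delta>t)\<close>, the mean follows the relaxed iteration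
  \<open>\<mu> \<mapsto> T \<mu> + q (\<mu> - T \<mu>)\<close>, whereas Consensus Hopping iterates \<open>T\<close>. So the distance \<open>e\<^sub>k\<close> of the two satisfies
  \<open>e\<^sub>k\<^sub>+\<^sub>1 \<le> e\<^sub>k / 2 + 2 R q\<close>, which gives \<open>e\<^sub>k \<le> 4 R q\<close>; translating one Gaussian onto the other bounds \<open>W\<^sub>2\<close>.\<close>

section \<open>Isotropic Gaussian measures\<close>

text \<open>The Gaussian law of the Freezing solution has to be derived: the solution is given only
  by its pathwise integral equation. With the consensus point frozen on a block, the drift is affine
  with rate s \<open>lam\<close>, so the mean relaxes exponentially towards \<open>T \<mu>\<close>;
  this is the origin of q. The noise has variance rate s \<delta>^2, hence the stationary variance
  is s \<delta>^2 / (2 s \<open>lam\<close>) = \<delta>^2 / (2 \<open>lam\<close>). The prescribed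
  \<sigma> is exactly this value, independent of s, and so the fluctuation around the mean keeps its
  law for every s. The estimates on T involve only f, R and \<sigma>, so their threshold for
  \<alpha> does not depend on s, on the probability space or on k. The minimiser lies strictly
  inside the ball, and concentration within the margin R - |x*| makes the ball invariant. There
  |\<mu> - T \<mu>| is at most 2 R, and 4 R q is the fixed point of e \<mapsto> e / 2 + 2 R q, which
  explains the constant 4.\<close>

lemma sets_gaussian [simp, measurable_cong]: "sets (gaussian m s) = sets borel"
  by (simp add: gaussian_def)

lemma space_gaussian [simp]: "space (gaussian m s) = UNIV"
  by (simp add: gaussian_def)

lemma nn_integral_gaussian:
  fixes g :: "'a::euclidean_space \<Rightarrow> ennreal"
  assumes [measurable]: "g \<in> borel_measurable borel"
  shows "(\<integral>\<^sup>+x. g x \<partial>gaussian m s) =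
    (\<integral>\<^sup>+x. ennreal (\<Prod>b\<in>Basis. normal_density (m \<bullet> b) s (x \<bullet> b)) * g x \<partial>lborel)"
  unfolding gaussian_def by (subst nn_integral_density) auto

lemma prob_space_gaussian:
  assumes "s > 0"
  shows "prob_space (gaussian (m::'a::euclidean_space) s)"
proof
  have "emeasure (gaussian m s) UNIV
      = (\<integral>\<^sup>+x. (\<Prod>b\<in>Basis. ennreal (normal_density (m \<bullet> b) s (x \<bullet> b))) \<partial>lborel)"
    unfolding gaussian_def by (simp add: emeasure_density prod_ennreal)
  also have "\<dots> = (\<Prod>b\<in>(Basis::'a set). (\<integral>\<^sup>+x. ennreal (normal_density (m \<bullet> b) s x) \<partial>lborel))"
    by (subst nn_integral_lborel_prod) auto
  also have "\<dots> = 1"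
    using assms by (simp add: nn_integral_eq_integral)
  finally show "emeasure (gaussian m s) (space (gaussian m s)) = 1" by simp
qed

lemma nn_integral_lborel_affine:
  fixes c :: "'a::euclidean_space"
  assumes [measurable]: "g \<in> borel_measurable borel" and "a \<noteq> 0"
  shows "(\<integral>\<^sup>+x. g x \<partial>lborel) = (\<integral>\<^sup>+x. ennreal (\<bar>a\<bar> ^ DIM('a)) * g (c + a *\<^sub>R x) \<partial>lborel)"
  by (subst lborel_affine[OF assms(2), of c])
     (simp add: nn_integral_density nn_integral_distr nn_integral_cmult)

text \<open>The Jacobian supplies one factor \<open>\<bar>a\<bar>\<close> per coordinate, and each
  is absorbed by the normalisation of the one-dimensional density (\<open>dens\<close>). Negative
  \<open>a\<close> is included because the reflection \<open>a = - 1\<close> serves to compute the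
  mean.\<close>

lemma distr_gaussian_affine:
  fixes c m :: "'a::euclidean_space"
  assumes s: "s > 0" and a: "a \<noteq> 0"
  shows "distr (gaussian m s) borel (\<lambda>x. c + a *\<^sub>R x) = gaussian (c + a *\<^sub>R m) (\<bar>a\<bar> * s)"
proof (rule measure_eqI)
  fix A assume "A \<in> sets (distr (gaussian m s) borel (\<lambda>x. c + a *\<^sub>R x))"
  then have [measurable]: "A \<in> sets borel" by simp
  have dens: "\<bar>a\<bar> ^ DIM('a) *
      (\<Prod>b\<in>Basis. normal_density ((c + a *\<^sub>R m) \<bullet> b) (\<bar>a\<bar> * s) ((c + a *\<^sub>R x) \<bullet> b)) =
      (\<Prod>b\<in>Basis. normal_density (m \<bullet> b) s (x \<bullet> b))" for x :: 'a
  proof -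
    have "\<bar>a\<bar> * normal_density ((c + a *\<^sub>R m) \<bullet> b) (\<bar>a\<bar> * s) ((c + a *\<^sub>R x) \<bullet> b)
        = normal_density (m \<bullet> b) s (x \<bullet> b)" for b
    proof -
      have "(a * (x \<bullet> b) - a * (m \<bullet> b))\<^sup>2 = a\<^sup>2 * (x \<bullet> b - m \<bullet> b)\<^sup>2"
        by (simp add: power_mult_distrib[symmetric] algebra_simps)
      moreover have "sqrt (2 * pi * (\<bar>a\<bar> * s)\<^sup>2) = \<bar>a\<bar> * sqrt (2 * pi * s\<^sup>2)"
        by (simp add: power_mult_distrib real_sqrt_mult)
      ultimately show ?thesis
        using a s by (simp add: normal_density_def inner_add_left inner_diff_left power_mult_distrib)
    qed
    then show ?thesis
      by (simp add: prod.distrib[symmetric] flip: prod_constant)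
  qed
  have "emeasure (gaussian (c + a *\<^sub>R m) (\<bar>a\<bar> * s)) A
     = (\<integral>\<^sup>+x. indicator A x \<partial>gaussian (c + a *\<^sub>R m) (\<bar>a\<bar> * s))" by simp
  also have "\<dots> = (\<integral>\<^sup>+x. ennreal (\<bar>a\<bar> ^ DIM('a)) *
      (ennreal (\<Prod>b\<in>Basis. normal_density ((c + a *\<^sub>R m) \<bullet> b) (\<bar>a\<bar> * s) ((c + a *\<^sub>R x) \<bullet> b))
        * indicator A (c + a *\<^sub>R x)) \<partial>lborel)"
    by (subst nn_integral_gaussian, measurable, subst nn_integral_lborel_affine[OF _ a, of _ c], measurable)
  also have "\<dots> = (\<integral>\<^sup>+x. ennreal (\<Prod>b\<in>Basis. normal_density (m \<bullet> b) s (x \<bullet> b))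
        * indicator A (c + a *\<^sub>R x) \<partial>lborel)"
    by (subst mult.assoc[symmetric], subst ennreal_mult'[symmetric]) (simp_all add: dens prod_nonneg)
  also have "\<dots> = (\<integral>\<^sup>+x. indicator A (c + a *\<^sub>R x) \<partial>gaussian m s)"
    by (subst nn_integral_gaussian) auto
  also have "\<dots> = (\<integral>\<^sup>+x. indicator A x \<partial>distr (gaussian m s) borel (\<lambda>x. c + a *\<^sub>R x))"
    by (subst nn_integral_distr) auto
  also have "\<dots> = emeasure (distr (gaussian m s) borel (\<lambda>x. c + a *\<^sub>R x)) A" by simp
  finally show "emeasure (distr (gaussian m s) borel (\<lambda>x. c + a *\<^sub>R x)) A
      = emeasure (gaussian (c + a *\<^sub>R m) (\<bar>a\<bar> * s)) A" ..
qed simp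

text \<open>Moves the parameters from the measure into the integrand, so that bounds uniform in
  \<open>m\<close> and limits in the parameters are taken over one fixed measure.\<close>

lemma gaussian_eq_distr_std:
  fixes m :: "'a::euclidean_space"
  assumes "s > 0"
  shows "gaussian m s = distr (gaussian 0 1) borel (\<lambda>z. m + s *\<^sub>R z)"
  using distr_gaussian_affine[of 1 s m 0] distr_gaussian_affine[of 1 s 0 m] assms by simp

text \<open>Tonelli and the shift \<open>x = z - y\<close> reduce the claim to a convolution of
  product densities, which factors over the coordinates into the one-dimensional rule.\<close>

lemma gaussian_convolution:
  assumes s: "s > 0" "t > 0"
  shows "distr (gaussian 0 s \<Otimes>\<^sub>M gaussian 0 t) borel (\<lambda>(x, y). x + y)
    = gaussian (0::'a::euclidean_space) (sqrt (s\<^sup>2 + t\<^sup>2))"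
proof (rule measure_eqI)
  fix A assume "A \<in> sets (distr (gaussian 0 s \<Otimes>\<^sub>M gaussian 0 t) borel (\<lambda>(x::'a, y). x + y))"
  then have [measurable]: "A \<in> sets borel" by simp
  let ?p = "\<lambda>s x::'a. \<Prod>b\<in>Basis. normal_density (0 \<bullet> b) s (x \<bullet> b)"
  have p[simp]: "?p s x \<ge> 0" for s x by (simp add: prod_nonneg)
  interpret S: prob_space "gaussian (0::'a) s" by (rule prob_space_gaussian) fact
  interpret T: prob_space "gaussian (0::'a) t" by (rule prob_space_gaussian) fact
  interpret ST: pair_prob_space "gaussian (0::'a) s" "gaussian (0::'a) t" ..
  have conv: "(\<integral>\<^sup>+y. ennreal (?p s (z - y) * ?p t y) \<partial>lborel) = ennreal (?p (sqrt (s\<^sup>2 + t\<^sup>2)) z)" for z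
  proof -
    have "(\<integral>\<^sup>+y. ennreal (?p s (z - y) * ?p t y) \<partial>lborel) =
      (\<integral>\<^sup>+y. (\<Prod>b\<in>Basis. ennreal (normal_density 0 s (z \<bullet> b - y \<bullet> b) * normal_density 0 t (y \<bullet> b))) \<partial>lborel)"
      by (simp add: prod.distrib[symmetric] prod_ennreal inner_diff_left)
    also have "\<dots> = (\<Prod>b\<in>Basis. (\<integral>\<^sup>+u. ennreal (normal_density 0 s (z \<bullet> b - u) * normal_density 0 t u) \<partial>lborel))"
      by (subst nn_integral_lborel_prod) auto
    also have "\<dots> = ennreal (?p (sqrt (s\<^sup>2 + t\<^sup>2)) z)"
      using conv_normal_density_zero_mean[OF s] by (simp add: fun_eq_iff prod_ennreal)
    finally show ?thesis .
  qed
  have shift: "(\<integral>\<^sup>+x. ennreal (?p s x * ?p t y) * indicator A (x + y) \<partial>lborel) =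
     (\<integral>\<^sup>+z. ennreal (?p s (z - y) * ?p t y) * indicator A z \<partial>lborel)" for y
    using nn_integral_lborel_affine[of "\<lambda>x. ennreal (?p s x * ?p t y) * indicator A (x + y)" 1 "- y"]
    by simp
  have "emeasure (distr (gaussian 0 s \<Otimes>\<^sub>M gaussian 0 t) borel (\<lambda>(x::'a, y). x + y)) A
     = (\<integral>\<^sup>+x. indicator A x \<partial>distr (gaussian 0 s \<Otimes>\<^sub>M gaussian 0 t) borel (\<lambda>(x::'a, y). x + y))" by simp
  also have "\<dots> = (\<integral>\<^sup>+p. indicator A (fst p + snd p) \<partial>(gaussian 0 s \<Otimes>\<^sub>M gaussian 0 t))"
    by (subst nn_integral_distr) (auto simp: case_prod_beta)
  also have "\<dots> = (\<integral>\<^sup>+x. \<integral>\<^sup>+y. indicator A (x + y) \<partial>gaussian 0 t \<partial>gaussian 0 s)"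
    by (subst T.nn_integral_fst[symmetric]) auto
  also have "\<dots> = (\<integral>\<^sup>+x. \<integral>\<^sup>+y. ennreal (?p s x * ?p t y) * indicator A (x + y) \<partial>lborel \<partial>lborel)"
    by (simp add: nn_integral_gaussian ennreal_mult[OF p p, simplified] mult.assoc nn_integral_cmult[symmetric])
  also have "\<dots> = (\<integral>\<^sup>+y. \<integral>\<^sup>+x. ennreal (?p s x * ?p t y) * indicator A (x + y) \<partial>lborel \<partial>lborel)"
    by (rule lborel_pair.Fubini') measurable
  also have "\<dots> = (\<integral>\<^sup>+y. \<integral>\<^sup>+z. ennreal (?p s (z - y) * ?p t y) * indicator A z \<partial>lborel \<partial>lborel)"
    by (rule nn_integral_cong) (rule shift)
  also have "\<dots> = (\<integral>\<^sup>+z. \<integral>\<^sup>+y. ennreal (?p s (z - y) * ?p t y) * indicator A z \<partial>lborel \<partial>lborel)"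
    by (rule lborel_pair.Fubini') measurable
  also have "\<dots> = (\<integral>\<^sup>+z. ennreal (?p (sqrt (s\<^sup>2 + t\<^sup>2)) z) * indicator A z \<partial>lborel)"
    by (rule nn_integral_cong, subst nn_integral_multc) (measurable, simp only: conv)
  also have "\<dots> = emeasure (gaussian 0 (sqrt (s\<^sup>2 + t\<^sup>2))) A"
    unfolding gaussian_def by (subst emeasure_density) auto
  finally show "emeasure (distr (gaussian 0 s \<Otimes>\<^sub>M gaussian 0 t) borel (\<lambda>(x::'a, y). x + y)) A
    = emeasure (gaussian 0 (sqrt (s\<^sup>2 + t\<^sup>2))) A" .
qed simp

lemma (in prob_space) distr_add_gaussian:
  assumes "indep_var borel X borel Y" and "s > 0" "t > 0"
    and "distr M borel X = gaussian (0::'b::euclidean_space) s" "distr M borel Y = gaussian 0 t"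
  shows "distr M borel (\<lambda>\<omega>. X \<omega> + Y \<omega>) = gaussian 0 (sqrt (s\<^sup>2 + t\<^sup>2))"
proof -
  have [measurable]: "X \<in> borel_measurable M" "Y \<in> borel_measurable M"
    using assms(1) by (auto dest: indep_var_rv1 indep_var_rv2)
  have "distr M borel (\<lambda>\<omega>. X \<omega> + Y \<omega>)
      = distr (distr M (borel \<Otimes>\<^sub>M borel) (\<lambda>\<omega>. (X \<omega>, Y \<omega>))) borel (\<lambda>(x, y). x + y)"
    by (subst distr_distr) (auto simp: comp_def)
  also have "distr M (borel \<Otimes>\<^sub>M borel) (\<lambda>\<omega>. (X \<omega>, Y \<omega>)) = gaussian 0 s \<Otimes>\<^sub>M gaussian 0 t"
    using assms(1,4,5) by (simp add: indep_var_distribution_eq)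
  finally show ?thesis using gaussian_convolution assms by metis
qed

text \<open>The norm is at most the sum of the absolute coordinates, so the exponential is dominated
  by a product and Tonelli applies. In one dimension exp (a |u|) \<le> exp (a u) + exp (- a u), and
  completing the square (\<open>e\<close>) makes each term a multiple of a shifted normal
  density.\<close>

lemma gaussian_exp_moment:
  assumes "s > 0"
  shows "integrable (gaussian (m::'a::euclidean_space) s) (\<lambda>x. exp (a * norm x))"
proof -
  have one: "(\<integral>\<^sup>+u. ennreal (normal_density 0 1 u * exp (a * \<bar>u\<bar>)) \<partial>lborel) < \<infinity>" for a
  proof -
    have e: "normal_density 0 1 u * exp (c * u) = exp (c\<^sup>2 / 2) * normal_density c 1 u" for u c :: real
    proof -
      have "- u\<^sup>2 / 2 + c * u = c\<^sup>2 / 2 + - (u - c)\<^sup>2 / 2"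
        by (simp add: power2_diff field_simps)
      then have "exp (- u\<^sup>2 / 2) * exp (c * u) = exp (c\<^sup>2 / 2) * exp (- (u - c)\<^sup>2 / 2)"
        by (simp only: exp_add[symmetric])
      then show ?thesis by (simp add: normal_density_def)
    qed
    have i: "integrable lborel (\<lambda>u. exp (a\<^sup>2 / 2) * normal_density a 1 u + exp (a\<^sup>2 / 2) * normal_density (- a) 1 u)"
      by auto
    have "(\<integral>\<^sup>+u. ennreal (normal_density 0 1 u * exp (a * \<bar>u\<bar>)) \<partial>lborel)
       \<le> (\<integral>\<^sup>+u. ennreal (exp (a\<^sup>2 / 2) * normal_density a 1 u + exp (a\<^sup>2 / 2) * normal_density (- a) 1 u) \<partial>lborel)"
      using e[of _ a] e[of _ "- a"]
      by (intro nn_integral_mono ennreal_leI) (auto simp: abs_if)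
    also have "\<dots> = ennreal (integral\<^sup>L lborel (\<lambda>u. exp (a\<^sup>2 / 2) * normal_density a 1 u + exp (a\<^sup>2 / 2) * normal_density (- a) 1 u))"
      by (intro nn_integral_eq_integral i) auto
    also have "\<dots> < \<infinity>" by simp
    finally show ?thesis .
  qed
  have std: "(\<integral>\<^sup>+z. ennreal (exp (a * norm z)) \<partial>gaussian (0::'a) 1) < \<infinity>" if "a \<ge> 0" for a
  proof -
    have "(\<integral>\<^sup>+z. ennreal (exp (a * norm z)) \<partial>gaussian (0::'a) 1)
       \<le> (\<integral>\<^sup>+z. ennreal (\<Prod>b\<in>Basis. exp (a * \<bar>z \<bullet> b\<bar>)) \<partial>gaussian (0::'a) 1)"
    proof (intro nn_integral_mono ennreal_leI)
      fix z :: 'a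
      have "a * norm z \<le> (\<Sum>b\<in>Basis. a * \<bar>z \<bullet> b\<bar>)"
        using norm_le_l1[of z] that by (simp add: sum_distrib_left[symmetric] mult_left_mono)
      then show "exp (a * norm z) \<le> (\<Prod>b\<in>Basis. exp (a * \<bar>z \<bullet> b\<bar>))"
        by (simp add: exp_sum[symmetric])
    qed
    also have "\<dots> = (\<integral>\<^sup>+z. (\<Prod>b\<in>Basis. ennreal (normal_density 0 1 (z \<bullet> b) * exp (a * \<bar>z \<bullet> b\<bar>))) \<partial>(lborel::'a measure))"
      by (simp add: nn_integral_gaussian prod_ennreal prod.distrib prod_nonneg ennreal_mult'[symmetric])
    also have "\<dots> = (\<Prod>b\<in>(Basis::'a set). (\<integral>\<^sup>+u. ennreal (normal_density 0 1 u * exp (a * \<bar>u\<bar>)) \<partial>lborel))"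
      by (subst nn_integral_lborel_prod) auto
    also have "\<dots> < \<infinity>"
      using one[of a] by (simp add: power_less_top_ennreal)
    finally show ?thesis .
  qed
  have "integrable (gaussian (0::'a) 1) (\<lambda>z. exp (\<bar>a\<bar> * norm m) * exp (\<bar>a\<bar> * s * norm z))"
    using std[of "\<bar>a\<bar> * s"] assms
    by (intro integrable_mult_right integrableI_bounded) auto
  then have "integrable (gaussian (0::'a) 1) (\<lambda>z. exp (a * norm (m + s *\<^sub>R z)))"
  proof (rule Bochner_Integration.integrable_bound)
    show "AE z in gaussian 0 1. norm (exp (a * norm (m + s *\<^sub>R z)))
        \<le> norm (exp (\<bar>a\<bar> * norm m) * exp (\<bar>a\<bar> * s * norm z))"
    proof (intro AE_I2)
      fix z :: 'a
      have "a * norm (m + s *\<^sub>R z) \<le> \<bar>a\<bar> * (norm m + s * norm z)"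
        using norm_triangle_ineq[of m "s *\<^sub>R z"] assms by (intro mult_mono) auto
      then show "norm (exp (a * norm (m + s *\<^sub>R z)))
          \<le> norm (exp (\<bar>a\<bar> * norm m) * exp (\<bar>a\<bar> * s * norm z))"
        by (simp add: exp_add[symmetric] algebra_simps)
    qed
  qed simp
  then show ?thesis
    by (subst gaussian_eq_distr_std[OF assms]) (simp add: integrable_distr_eq)
qed

lemma integrable_gaussian_ident:
  assumes "s > 0"
  shows "integrable (gaussian (m::'a::euclidean_space) s) (\<lambda>x. x)"
proof (rule Bochner_Integration.integrable_bound[OF gaussian_exp_moment[OF assms, of _ 1]])
  show "AE x in gaussian m s. norm x \<le> norm (exp (1 * norm x))"
  proof (intro AE_I2)
    fix x :: 'a show "norm x \<le> norm (exp (1 * norm x))"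
      using exp_ge_add_one_self[of "norm x"] unfolding real_norm_def abs_exp_cancel mult_1 by linarith
  qed
qed simp

text \<open>By reflection symmetry the mean of the standard Gaussian equals its own negative; the
  general case is an affine image.\<close>

lemma mean_gaussian:
  assumes "s > 0"
  shows "mean (gaussian (m::'a::euclidean_space) s) = m"
proof -
  interpret prob_space "gaussian (0::'a) 1" by (rule prob_space_gaussian) simp
  have i: "integrable (gaussian (0::'a) 1) (\<lambda>x. x)" by (rule integrable_gaussian_ident) simp
  have "gaussian (0::'a) 1 = distr (gaussian 0 1) borel uminus"
    using distr_gaussian_affine[of 1 "-1" "0::'a" 0] by simp
  then have "(\<integral>x. x \<partial>gaussian (0::'a) 1) = (\<integral>x. x \<partial>distr (gaussian (0::'a) 1) borel uminus)"
    by simp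
  also have "\<dots> = - (\<integral>x. x \<partial>gaussian (0::'a) 1)"
    by (subst integral_distr) auto
  finally have z: "(\<integral>x. x \<partial>gaussian (0::'a) 1) = 0"
    by (metis add.right_inverse one_neq_zero scaleR_2 scaleR_eq_0_iff zero_neq_numeral)
  have "mean (gaussian m s) = (\<integral>z. m + s *\<^sub>R z \<partial>gaussian 0 1)"
    unfolding mean_def by (subst gaussian_eq_distr_std[OF assms], subst integral_distr) auto
  also have "\<dots> = m" using i z prob_space by simp
  finally show ?thesis .
qed

text \<open>Coupling x with its translate x + (m' - m) moves every point by the same vector, so the
  cost of this one coupling is |m - m'|^2.\<close>

lemma wasserstein2_gaussian_shift:
  assumes "s > 0"
  shows "wasserstein2 (gaussian m s) (gaussian m' s) \<le> ennreal (norm (m - m'))"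
proof -
  define \<pi> where "\<pi> = distr (gaussian m s) borel (\<lambda>x. (x, (m' - m) + 1 *\<^sub>R x))"
  interpret prob_space "gaussian m s" by (rule prob_space_gaussian) fact
  have mp[measurable]: "(\<lambda>x. (x, (m' - m) + 1 *\<^sub>R x)) \<in> measurable (gaussian m s) borel"
    by (subst borel_prod[symmetric]) measurable
  have "\<pi> \<in> couplings (gaussian m s) (gaussian m' s)"
  proof -
    have "distr \<pi> borel fst = distr (gaussian m s) borel (\<lambda>x. x)"
      unfolding \<pi>_def by (subst distr_distr) (auto simp: comp_def borel_prod[symmetric])
    also have "\<dots> = gaussian m s"
      by (rule distr_id2) simp
    finally have 1: "distr \<pi> borel fst = gaussian m s" .
    have "distr \<pi> borel snd = distr (gaussian m s) borel (\<lambda>x. (m' - m) + 1 *\<^sub>R x)"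
      unfolding \<pi>_def by (subst distr_distr) (auto simp: comp_def borel_prod[symmetric])
    also have "\<dots> = gaussian m' s"
      using assms by (subst distr_gaussian_affine) auto
    finally show ?thesis using 1 by (simp add: couplings_def \<pi>_def)
  qed
  then have "(INF \<pi>\<in>couplings (gaussian m s) (gaussian m' s). \<integral>\<^sup>+p. ennreal ((dist (fst p) (snd p))\<^sup>2) \<partial>\<pi>)
      \<le> (\<integral>\<^sup>+p. ennreal ((dist (fst p) (snd p))\<^sup>2) \<partial>\<pi>)" (is "?c \<le> _")
    by (rule INF_lower)
  also have "\<dots> = (\<integral>\<^sup>+x. ennreal ((norm (m - m'))\<^sup>2) \<partial>gaussian m s)"
    unfolding \<pi>_def by (subst nn_integral_distr) (auto simp: dist_norm borel_prod[symmetric])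
  also have "\<dots> = ennreal ((norm (m - m'))\<^sup>2)"
    using emeasure_space_1 by simp
  finally have c: "?c \<le> ennreal ((norm (m - m'))\<^sup>2)" .
  \<comment> \<open>A finite cost selects the square-root branch of
    \<open>wasserstein2\<close>.\<close>
  then have "?c \<noteq> \<top>" using neq_top_trans ennreal_neq_top by blast
  moreover have "sqrt (enn2real ?c) \<le> norm (m - m')"
    using c by (intro real_le_lsqrt) (auto intro: enn2real_leI)
  ultimately show ?thesis
    unfolding wasserstein2_def Let_def by (simp only: if_False ennreal_leI)
qed

section \<open>Identification of laws by bounded continuous test functions\<close>

lemma finite_measure_eqI_bounded_continuous:
  fixes M N :: "'a::metric_space measure"
  assumes sets: "sets M = sets borel" "sets N = sets borel"
    and fin: "finite_measure M" "finite_measure N"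
    and eq: "\<And>g::'a \<Rightarrow> real. continuous_on UNIV g \<Longrightarrow> (\<And>x. \<bar>g x\<bar> \<le> 1) \<Longrightarrow> (\<integral>x. g x \<partial>M) = (\<integral>x. g x \<partial>N)"
  shows "M = N"
proof -
  have closed: "emeasure M F = emeasure N F" if F: "closed F" for F
  proof (cases "F = {}")
    \<comment> \<open>The distance \<open>infdist x {}\<close> is 0 by convention, so for empty
      \<open>F\<close> the functions \<open>g n\<close> below would be constantly 1; hence the case
      split.\<close>
    case False
    \<comment> \<open>For positive \<open>n\<close> these are bumps equal to 1 on \<open>F\<close>
      and 0 at distance at least 1/n. A point outside the closed set \<open>F\<close> has positive
      distance from it, so they converge pointwise to the indicator.\<close>
    define g where "g n x = max 0 (1 - real n * infdist x F)" for n x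
    have g1: "\<bar>g n x\<bar> \<le> 1" for n x by (auto simp: g_def infdist_nonneg)
    have gc: "continuous_on UNIV (g n)" for n unfolding g_def by (intro continuous_intros)
    have lim: "(\<lambda>n. g n x) \<longlonglongrightarrow> indicator F x" for x
    proof (cases "x \<in> F")
      case True then show ?thesis by (simp add: g_def)
    next
      case x: False
      then have d: "infdist x F > 0"
        using F False in_closed_iff_infdist_zero[of F x] infdist_nonneg[of x F] by force
      obtain n0 where n0: "1 < real n0 * infdist x F" using d reals_Archimedean3 by blast
      have "g n x = 0" if "n \<ge> n0" for n
      proof -
        have "real n0 * infdist x F \<le> real n * infdist x F"
          using that d by (intro mult_right_mono) auto
        then show ?thesis using n0 by (simp add: g_def)
      qed
      then have "eventually (\<lambda>n. g n x = 0) sequentially"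
        by (auto simp: eventually_sequentially)
      then show ?thesis using x by (simp add: tendsto_eventually)
    qed
    have L: "(\<lambda>n. \<integral>x. g n x \<partial>K) \<longlonglongrightarrow> measure K F"
      if "sets K = sets borel" "finite_measure K" for K :: "'a measure"
    proof -
      interpret finite_measure K by fact
      have [measurable_cong]: "sets K = sets borel" by fact
      have [measurable]: "g n \<in> borel_measurable borel" for n
        using gc by (rule borel_measurable_continuous_onI)
      have sp: "space K = UNIV" using sets_eq_imp_space_eq[OF that(1)] by simp
      have Fs: "F \<in> sets K" using F that(1) by auto
      have "(\<lambda>n. \<integral>x. g n x \<partial>K) \<longlonglongrightarrow> (\<integral>x. indicator F x \<partial>K)"
        by (rule integral_dominated_convergence[where w="\<lambda>_. 1"])
           (use g1 lim Fs in \<open>auto simp: sp\<close>)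
      then show ?thesis using Fs sp by simp
    qed
    have "measure M F = measure N F"
      using L[OF sets(1) fin(1)] L[OF sets(2) fin(2)] eq[OF gc g1]
      by (simp add: LIMSEQ_unique)
    then show ?thesis
      using fin by (simp add: finite_measure.emeasure_eq_measure)
  qed simp
  show ?thesis
  proof (rule measure_eqI_generator_eq[where \<Omega>=UNIV and E="Collect closed" and A="\<lambda>_. UNIV"])
    show "Int_stable (Collect closed :: 'a set set)" by (auto simp: Int_stable_def)
    show "sets M = sigma_sets UNIV (Collect closed)" "sets N = sigma_sets UNIV (Collect closed)"
      using sets by (simp_all add: borel_eq_closed)
    show "emeasure M UNIV \<noteq> \<infinity>"
      using finite_measure.emeasure_finite[OF fin(1)] by simp
  qed (use closed in auto)
qed

text \<open>Weak convergence: \<open>E g(Z n)\<close> converges both to \<open>E g(Y)\<close> and, writing the law of \<open>Z n\<close> as an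
  affine image of a fixed Gaussian, to the expectation of \<open>g\<close> under the limit Gaussian.\<close>

lemma (in prob_space) distr_AE_limit_gaussian:
  fixes Z :: "nat \<Rightarrow> 'a \<Rightarrow> 'b::euclidean_space"
  assumes [measurable]: "\<And>n. Z n \<in> borel_measurable M" "Y \<in> borel_measurable M"
    and lim: "AE \<omega> in M. (\<lambda>n. Z n \<omega>) \<longlonglongrightarrow> Y \<omega>"
    and law: "\<forall>\<^sub>F n in sequentially. distr M borel (Z n) = gaussian m (s n)"
    and pos: "\<forall>\<^sub>F n in sequentially. s n > 0" "s' > 0" and s: "s \<longlonglongrightarrow> s'"
  shows "distr M borel Y = gaussian m s'"
proof (rule finite_measure_eqI_bounded_continuous)
  interpret G: prob_space "gaussian (0::'b) 1" by (rule prob_space_gaussian) simp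
  show "finite_measure (gaussian m s')"
    using prob_space_gaussian[OF pos(2)] by (rule prob_space.finite_measure)
  show "finite_measure (distr M borel Y)"
    by (rule prob_space.finite_measure) (simp add: prob_space_distr)
  fix g :: "'b \<Rightarrow> real" assume gc: "continuous_on UNIV g" and g1: "\<And>x. \<bar>g x\<bar> \<le> 1"
  have [measurable]: "g \<in> borel_measurable borel" using gc by (rule borel_measurable_continuous_onI)
  have ig: "isCont g x" for x using gc by (simp add: continuous_on_eq_continuous_at)
  have 1: "(\<lambda>n. \<integral>\<omega>. g (Z n \<omega>) \<partial>M) \<longlonglongrightarrow> (\<integral>\<omega>. g (Y \<omega>) \<partial>M)"
  proof (rule integral_dominated_convergence[where w="\<lambda>_. 1"])
    show "AE \<omega> in M. (\<lambda>n. g (Z n \<omega>)) \<longlonglongrightarrow> g (Y \<omega>)"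
      using lim by eventually_elim (rule isCont_tendsto_compose[OF ig])
  qed (use g1 in auto)
  have 2: "(\<lambda>n. \<integral>z. g (m + s n *\<^sub>R z) \<partial>gaussian 0 1) \<longlonglongrightarrow> (\<integral>z. g (m + s' *\<^sub>R z) \<partial>gaussian 0 1)"
    by (rule integral_dominated_convergence[where w="\<lambda>_. 1"])
       (use s g1 in \<open>auto intro!: isCont_tendsto_compose[OF ig] tendsto_intros\<close>)
  have 3: "\<forall>\<^sub>F n in sequentially. (\<integral>\<omega>. g (Z n \<omega>) \<partial>M) = (\<integral>z. g (m + s n *\<^sub>R z) \<partial>gaussian 0 1)"
    using law pos(1)
  proof eventually_elim
    case (elim n)
    have "(\<integral>\<omega>. g (Z n \<omega>) \<partial>M) = (\<integral>x. g x \<partial>distr M borel (Z n))"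
      by (subst integral_distr) auto
    also have "\<dots> = (\<integral>z. g (m + s n *\<^sub>R z) \<partial>gaussian 0 1)"
      unfolding elim(1) gaussian_eq_distr_std[OF elim(2)] by (subst integral_distr) auto
    finally show ?case .
  qed
  have "(\<integral>\<omega>. g (Y \<omega>) \<partial>M) = (\<integral>z. g (m + s' *\<^sub>R z) \<partial>gaussian 0 1)"
    using Lim_transform_eventually[OF 1 3] 2 by (rule LIMSEQ_unique)
  then show "(\<integral>x. g x \<partial>distr M borel Y) = (\<integral>x. g x \<partial>gaussian m s')"
    unfolding gaussian_eq_distr_std[OF pos(2)] by (simp add: integral_distr)
qed simp_all

section \<open>Consensus points of Gaussians for large \<open>\<alpha>\<close>\<close>

text \<open>Two regions contribute a gap. Beyond norm \<open>Mf\<close> the growth bound gives at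
  least \<open>cl * Mf\<^sup>2\<close>; on the remaining compact set \<open>K\<close> the minimum is
  attained away from \<open>xstar\<close>, and uniqueness makes it strictly larger than
  \<open>f xstar\<close>.\<close>

lemma quadratic_growth_separation:
  fixes f :: "'a::euclidean_space \<Rightarrow> real"
  assumes "continuous_on UNIV f"
    and min: "\<And>x. f xstar \<le> f x" and uniq: "\<And>x. f x = f xstar \<Longrightarrow> x = xstar"
    and c: "cl > 0" "Mf > 0" and growth: "\<And>x. norm x \<ge> Mf \<Longrightarrow> cl * (norm x)\<^sup>2 \<le> f x - f xstar"
    and r: "r > 0"
  shows "\<exists>c>0. \<forall>x. norm (x - xstar) \<ge> r \<longrightarrow> f xstar + c \<le> f x"
proof -
  define K where "K = cball 0 Mf - ball xstar r"
  have far: "f xstar + cl * Mf\<^sup>2 \<le> f x" if "norm x \<ge> Mf" for x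
  proof -
    have "cl * Mf\<^sup>2 \<le> cl * (norm x)\<^sup>2" using that c by (intro mult_left_mono power_mono) auto
    then show ?thesis using growth[OF that] by linarith
  qed
  have pos: "cl * Mf\<^sup>2 > 0" using c by simp
  have K: "compact K" unfolding K_def by (intro compact_diff) auto
  show ?thesis
  proof (cases "K = {}")
    \<comment> \<open>There is no minimiser over an empty \<open>K\<close>, but then every point at
      distance at least \<open>r\<close> already has norm at least \<open>Mf\<close>.\<close>
    case True
    then have "norm x \<ge> Mf" if "norm (x - xstar) \<ge> r" for x
    proof -
      have "x \<notin> K" using True by simp
      then show ?thesis using that by (auto simp: K_def dist_norm norm_minus_commute)
    qed
    then show ?thesis using far pos by blast
  next
    case False
    obtain xm where xm: "xm \<in> K" "\<forall>x\<in>K. f xm \<le> f x"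
      using continuous_attains_inf[OF K False] assms(1) continuous_on_subset by blast
    have "xm \<noteq> xstar" using xm(1) r by (auto simp: K_def)
    then have p: "f xm - f xstar > 0" using min[of xm] uniq[of xm] by force
    have "f xstar + Min {f xm - f xstar, cl * Mf\<^sup>2} \<le> f x" if "norm (x - xstar) \<ge> r" for x
    proof (cases "norm x \<ge> Mf")
      case True then show ?thesis using far[OF True] by simp
    next
      case False
      then have "x \<in> K" using that by (auto simp: K_def dist_norm norm_minus_commute)
      then show ?thesis using xm(2) by fastforce
    qed
    then show ?thesis using p pos by (intro exI[of _ "Min {f xm - f xstar, cl * Mf\<^sup>2}"]) auto
  qed
qed

lemma integrable_gaussian_weighted:
  fixes f :: "'a::euclidean_space \<Rightarrow> real" and g :: "'a \<Rightarrow> 'b::{banach,second_countable_topology}"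
  assumes "s > 0" and "\<alpha> \<ge> 0"
    and [measurable]: "f \<in> borel_measurable borel" "g \<in> borel_measurable borel"
    and min: "\<And>x. f xstar \<le> f x"
    and g: "\<And>x. norm (g x) \<le> C * exp (a * norm x)"
  shows "integrable (gaussian m s) (\<lambda>x. exp (- \<alpha> * f x) *\<^sub>R g x)"
proof (rule Bochner_Integration.integrable_bound)
  show "integrable (gaussian m s) (\<lambda>x. exp (- \<alpha> * f xstar) * (C * exp (a * norm x)))"
    using gaussian_exp_moment[OF assms(1)] by auto
  show "AE x in gaussian m s. norm (exp (- \<alpha> * f x) *\<^sub>R g x)
      \<le> norm (exp (- \<alpha> * f xstar) * (C * exp (a * norm x)))"
  proof (intro AE_I2)
    fix x
    have "exp (- \<alpha> * f x) * norm (g x) \<le> exp (- \<alpha> * f xstar) * (C * exp (a * norm x))"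
      using min[of x] assms(2) g[of x] by (intro mult_mono) (auto simp: mult_left_mono)
    then show "norm (exp (- \<alpha> * f x) *\<^sub>R g x)
      \<le> norm (exp (- \<alpha> * f xstar) * (C * exp (a * norm x)))"
      unfolding real_norm_def by (intro order_trans[OF _ abs_ge_self]) simp
  qed
qed simp

section \<open>Exponential weights and Laplace concentration\<close>

lemma le_exp: "x \<le> exp x" for x :: real
  using exp_ge_add_one_self[of x] by linarith

text \<open>Brings the weight centred at \<open>y\<close> into the form
  \<open>C * exp (a * norm x)\<close> required by \<open>integrable_gaussian_weighted\<close>;
  absorbing the linear factor raises the rate from \<open>K\<close> to \<open>K + 1\<close>.\<close>

lemma exp_norm_diff_bound:
  fixes x :: "'a::real_normed_vector"
  assumes "K \<ge> 0"
  shows "norm (x - y) * exp (K * norm (x - y)) \<le> exp ((K + 1) * norm y) * exp ((K + 1) * norm x)"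
proof -
  have "norm (x - y) * exp (K * norm (x - y)) \<le> exp (norm (x - y)) * exp (K * norm (x - y))"
    by (intro mult_right_mono le_exp) auto
  also have "\<dots> = exp ((K + 1) * norm (x - y))" by (simp add: exp_add[symmetric] algebra_simps)
  also have "\<dots> \<le> exp ((K + 1) * (norm y + norm x))"
    using norm_triangle_ineq4[of x y] assms by (simp add: mult_left_mono add.commute)
  also have "\<dots> = exp ((K + 1) * norm y) * exp ((K + 1) * norm x)"
    by (simp add: exp_add[symmetric] algebra_simps)
  finally show ?thesis .
qed

text \<open>On the ball every coordinate of \<open>x - m\<close> is at most \<open>D\<close> in
  absolute value, so the density is at least \<open>q\<close> whatever \<open>m\<close> is.
  Uniformity matters because one threshold for \<open>\<alpha>\<close> has to serve all means of
  norm at most \<open>R\<close>.\<close>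

lemma gaussian_ball_lower_bound:
  assumes "s > 0" "r > 0"
  shows "\<exists>p>0. \<forall>m::'a::euclidean_space. norm m \<le> R \<longrightarrow> p \<le> measure (gaussian m s) (ball y r)"
proof -
  define D where "D = r + norm y + \<bar>R\<bar>"
  define q where "q = (1 / sqrt (2 * pi * s\<^sup>2) * exp (- D\<^sup>2 / (2 * s\<^sup>2))) ^ DIM('a)"
  have q: "q > 0" using assms by (simp add: q_def)
  have B: "measure lborel (ball y r) > 0"
    using content_ball_pos assms(2) by simp
  have "q * measure lborel (ball y r) \<le> measure (gaussian m s) (ball y r)" if m: "norm m \<le> R" for m
  proof -
    interpret prob_space "gaussian m s" by (rule prob_space_gaussian) fact
    have dens: "q \<le> (\<Prod>b\<in>Basis. normal_density (m \<bullet> b) s (x \<bullet> b))" if x: "x \<in> ball y r" for x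
      unfolding q_def prod_constant[symmetric]
    proof (intro prod_mono conjI)
      fix b :: 'a assume b: "b \<in> Basis"
      have "\<bar>x \<bullet> b - m \<bullet> b\<bar> \<le> norm (x - m)"
        using Basis_le_norm[OF b, of "x - m"] by (simp add: inner_diff_left)
      also have "\<dots> \<le> D"
        using x m norm_triangle_ineq[of "x - y" "y - m"] norm_triangle_ineq4[of y m]
        by (simp add: D_def dist_norm norm_minus_commute)
      finally have "(x \<bullet> b - m \<bullet> b)\<^sup>2 \<le> D\<^sup>2" by (metis abs_ge_zero power2_abs power_mono)
      then show "1 / sqrt (2 * pi * s\<^sup>2) * exp (- D\<^sup>2 / (2 * s\<^sup>2)) \<le> normal_density (m \<bullet> b) s (x \<bullet> b)"
        unfolding normal_density_def using assms(1)
        by (intro mult_left_mono) (auto simp: divide_right_mono)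
    qed simp
    have "ennreal (q * measure lborel (ball y r)) = ennreal q * emeasure lborel (ball y r)"
      using q emeasure_lborel_ball_finite[of y r]
      by (simp add: ennreal_mult emeasure_eq_ennreal_measure[of lborel "ball y r"] less_top)
    also have "\<dots> = (\<integral>\<^sup>+x. ennreal q * indicator (ball y r) x \<partial>lborel)"
      by (rule nn_integral_cmult_indicator[symmetric]) simp
    also have "\<dots> \<le> (\<integral>\<^sup>+x. ennreal (\<Prod>b\<in>Basis. normal_density (m \<bullet> b) s (x \<bullet> b)) * indicator (ball y r) x \<partial>lborel)"
      using dens by (intro nn_integral_mono) (auto simp: indicator_def intro!: ennreal_leI)
    also have "\<dots> = emeasure (gaussian m s) (ball y r)"
      unfolding gaussian_def by (subst emeasure_density) auto
    finally show ?thesis by (simp add: emeasure_eq_measure)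
  qed
  then show ?thesis using q B by (intro exI[of _ "q * measure lborel (ball y r)"]) auto
qed

text \<open>The exponential weight leaves room for the density ratio of two Gaussians with different means,
  which enters when consensus points are compared.\<close>

lemma laplace_concentration:
  fixes f :: "'a::euclidean_space \<Rightarrow> real"
  assumes s: "s > 0" and fc: "continuous_on UNIV f" and min: "\<And>x. f xstar \<le> f x"
    and sep: "\<forall>r>0. \<exists>c>0. \<forall>x. norm (x - xstar) \<ge> r \<longrightarrow> f xstar + c \<le> f x"
    and K: "K \<ge> 0" and e: "e > 0"
  shows "\<exists>\<alpha>1>0. \<forall>\<alpha>\<ge>\<alpha>1. \<forall>m. norm m \<le> R \<longrightarrow>
     (\<integral>x. exp (- \<alpha> * f x) * (norm (x - xstar) * exp (K * norm (x - xstar))) \<partial>gaussian m s)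
       \<le> e * (\<integral>x. exp (- \<alpha> * f x) \<partial>gaussian m s)"
proof -
  define G where "G = (\<lambda>x::'a. norm (x - xstar) * exp (K * norm (x - xstar)))"
  have [measurable]: "f \<in> borel_measurable borel" using fc by (rule borel_measurable_continuous_onI)
  have [measurable]: "G \<in> borel_measurable borel" unfolding G_def by measurable
  have G0: "G x \<ge> 0" for x by (simp add: G_def)
  have Gle: "G x \<le> exp ((K + 1) * norm xstar) * exp ((K + 1) * norm x)" for x
    unfolding G_def using exp_norm_diff_bound[OF K] .
  \<comment> \<open>Within radius \<open>r\<close> the function \<open>G\<close> is at most
    \<open>r * exp K \<le> e / 2\<close>; the bound \<open>r \<le> 1\<close> keeps the exponent
    below \<open>K\<close>.\<close>
  define r where "r = Min {1, e / (2 * exp K)}"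
  have r: "r > 0" "r \<le> 1" "r * exp K \<le> e / 2"
    using e by (auto simp: r_def min_def field_simps)
  have near: "G x \<le> e / 2" if "norm (x - xstar) < r" for x
  proof -
    have "G x \<le> r * exp (K * 1)"
      unfolding G_def using that r K by (intro mult_mono exp_le_cancel_iff[THEN iffD2] mult_left_mono) auto
    then show ?thesis using r by simp
  qed
  obtain c where c: "c > 0" "\<And>x. norm (x - xstar) \<ge> r \<Longrightarrow> f xstar + c \<le> f x"
    using sep r(1) by blast
  \<comment> \<open>The tolerance is half of the gap: points near \<open>xstar\<close> have weight
    at least \<open>exp (- \<alpha> * (f xstar + c / 2))\<close>, far points at most
    \<open>exp (- \<alpha> * (f xstar + c))\<close>, and the quotient decays like
    \<open>exp (- \<alpha> * c / 2)\<close>.\<close>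
  have "isCont f xstar" using fc by (simp add: continuous_on_eq_continuous_at)
  then obtain r' where r': "r' > 0" "\<And>x. dist x xstar < r' \<Longrightarrow> dist (f x) (f xstar) < c / 2"
    using c(1) unfolding continuous_at_eps_delta by (metis half_gt_zero)
  obtain p where p: "p > 0" "\<And>m. norm m \<le> R \<Longrightarrow> p \<le> measure (gaussian m s) (ball xstar r')"
    using gaussian_ball_lower_bound[OF s r'(1)] by blast
  \<comment> \<open>Dominates \<open>G (m + s *\<^sub>R z)\<close> for all \<open>m\<close> of norm
    at most \<open>R\<close> at once, so that \<open>C\<close> does not depend on
    \<open>m\<close>.\<close>
  define H where "H = (\<lambda>z::'a. exp ((K + 1) * (norm xstar + \<bar>R\<bar>)) * exp ((K + 1) * s * norm z))"
  have iH: "integrable (gaussian 0 1) H"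
    unfolding H_def using gaussian_exp_moment[of 1 0 "(K + 1) * s"] by auto
  define C where "C = integral\<^sup>L (gaussian 0 1) H"
  have C0: "C \<ge> 0" unfolding C_def H_def by (intro integral_nonneg_AE) auto
  have iG: "integrable (gaussian m s) G" for m
    using integrable_gaussian_weighted[OF s, of 0 f G xstar "exp ((K + 1) * norm xstar)" "K + 1" m]
      min Gle G0 by simp
  have CG: "integral\<^sup>L (gaussian m s) G \<le> C" if m: "norm m \<le> R" for m
  proof -
    have "integral\<^sup>L (gaussian m s) G = (\<integral>z. G (m + s *\<^sub>R z) \<partial>gaussian 0 1)"
      by (subst gaussian_eq_distr_std[OF s], subst integral_distr) auto
    also have "\<dots> \<le> C"
      unfolding C_def
    proof (rule integral_mono)
      show "integrable (gaussian 0 1) (\<lambda>z. G (m + s *\<^sub>R z))"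
        using iG[of m] unfolding gaussian_eq_distr_std[OF s, of m] by (simp add: integrable_distr_eq)
      fix z
      have "norm (m + s *\<^sub>R z) \<le> \<bar>R\<bar> + s * norm z"
        using norm_triangle_ineq[of m "s *\<^sub>R z"] m s by simp
      then have "(K + 1) * norm (m + s *\<^sub>R z) \<le> (K + 1) * (\<bar>R\<bar> + s * norm z)"
        using K by (intro mult_left_mono) auto
      then have "exp ((K + 1) * norm xstar) * exp ((K + 1) * norm (m + s *\<^sub>R z))
          \<le> exp ((K + 1) * norm xstar) * exp ((K + 1) * (\<bar>R\<bar> + s * norm z))" by simp
      also have "\<dots> = H z" by (simp add: H_def exp_add[symmetric] algebra_simps)
      finally show "G (m + s *\<^sub>R z) \<le> H z"
        using Gle[of "m + s *\<^sub>R z"] by linarith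
    qed fact
    finally show ?thesis .
  qed
  \<comment> \<open>With \<open>u = \<alpha> * c / 2\<close> this threshold yields
    \<open>C \<le> u * (e / 2 * p)\<close>, and \<open>u \<le> exp u\<close> converts the linear
    gain into the exponential one. The summand 1 ensures positivity even for
    \<open>C = 0\<close>.\<close>
  define \<alpha>1 where "\<alpha>1 = 4 * C / (c * e * p) + 1"
  have \<alpha>1: "\<alpha>1 > 0" using C0 c e p by (simp add: \<alpha>1_def add_nonneg_pos)
  have "(\<integral>x. exp (- \<alpha> * f x) * G x \<partial>gaussian m s) \<le> e * (\<integral>x. exp (- \<alpha> * f x) \<partial>gaussian m s)"
    if \<alpha>: "\<alpha> \<ge> \<alpha>1" and m: "norm m \<le> R" for \<alpha> m
  proof -
    interpret prob_space "gaussian m s" by (rule prob_space_gaussian) fact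
    have a0: "\<alpha> > 0" using \<alpha> \<alpha>1 by simp
    define Z where "Z = (\<integral>x. exp (- \<alpha> * f x) \<partial>gaussian m s)"
    have iE: "integrable (gaussian m s) (\<lambda>x. exp (- \<alpha> * f x))"
      using integrable_gaussian_weighted[OF s, of \<alpha> f "\<lambda>_. 1::real" xstar 1 0] a0 min by simp
    have iEG: "integrable (gaussian m s) (\<lambda>x. exp (- \<alpha> * f x) * G x)"
      using integrable_gaussian_weighted[OF s, of \<alpha> f G xstar "exp ((K + 1) * norm xstar)" "K + 1"] a0 min Gle G0 by simp
    have iI: "integrable (gaussian m s) (indicator (ball xstar r') :: 'a \<Rightarrow> real)"
      by (rule integrable_real_indicator) (simp_all add: emeasure_eq_measure)
    have "exp (- \<alpha> * (f xstar + c / 2)) * p \<le> exp (- \<alpha> * (f xstar + c / 2)) * prob (ball xstar r')"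
      using p(2)[OF m] by simp
    also have "\<dots> = (\<integral>x. exp (- \<alpha> * (f xstar + c / 2)) * indicator (ball xstar r') x \<partial>gaussian m s)"
      by simp
    also have "\<dots> \<le> Z"
      unfolding Z_def
    proof (rule integral_mono[OF integrable_mult_right[OF iI] iE])
      fix x
      show "exp (- \<alpha> * (f xstar + c / 2)) * indicator (ball xstar r') x \<le> exp (- \<alpha> * f x)"
      proof (cases "x \<in> ball xstar r'")
        case True
        then have "\<bar>f x - f xstar\<bar> < c / 2" using r'(2)[of x] by (simp only: mem_ball dist_commute dist_real_def)
          then have "f x \<le> f xstar + c / 2" by linarith
        then have "\<alpha> * f x \<le> \<alpha> * (f xstar + c / 2)" using a0 by (intro mult_left_mono) auto
        then show ?thesis using True by simp
      qed simp
    qed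
    finally have Zl: "exp (- \<alpha> * (f xstar + c / 2)) * p \<le> Z" .
    \<comment> \<open>Half of \<open>e\<close> pays for the points within \<open>r\<close>, where
      \<open>G\<close> is small. The second term carries the full gap \<open>c\<close>, and its
      integral is absorbed by the other half.\<close>
    have ineq: "exp (- \<alpha> * f x) * G x \<le> e / 2 * exp (- \<alpha> * f x) + exp (- \<alpha> * (f xstar + c)) * G x" for x
    proof (cases "norm (x - xstar) < r")
      case True
      then show ?thesis using near[OF True] G0[of x] mult_left_mono[OF near[OF True], of "exp (- \<alpha> * f x)"]
        by (simp add: add_increasing2 mult.commute)
    next
      case False
      then have "\<alpha> * (f xstar + c) \<le> \<alpha> * f x" using c(2)[of x] a0 by (intro mult_left_mono) auto
      then have "exp (- \<alpha> * f x) * G x \<le> exp (- \<alpha> * (f xstar + c)) * G x"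
        using G0 by (intro mult_right_mono) auto
      moreover have "0 \<le> e / 2 * exp (- \<alpha> * f x)" using e by simp
      ultimately show ?thesis by linarith
    qed
    have iR: "integrable (gaussian m s) (\<lambda>x. e / 2 * exp (- \<alpha> * f x) + exp (- \<alpha> * (f xstar + c)) * G x)"
      by (intro Bochner_Integration.integrable_add integrable_mult_right iE iG)
    have "(\<integral>x. exp (- \<alpha> * f x) * G x \<partial>gaussian m s)
        \<le> (\<integral>x. e / 2 * exp (- \<alpha> * f x) + exp (- \<alpha> * (f xstar + c)) * G x \<partial>gaussian m s)"
      by (rule integral_mono[OF iEG iR ineq])
    also have "\<dots> = e / 2 * Z + exp (- \<alpha> * (f xstar + c)) * integral\<^sup>L (gaussian m s) G"
      unfolding Z_def using iE iG by simp
    also have "\<dots> \<le> e / 2 * Z + exp (- \<alpha> * (f xstar + c)) * C"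
      using CG[OF m] by simp
    also have "exp (- \<alpha> * (f xstar + c)) * C \<le> e / 2 * (exp (- \<alpha> * (f xstar + c / 2)) * p)"
    proof -
      define u where "u = \<alpha> * c / 2"
      have u: "u > 0" using a0 c by (simp add: u_def)
      have "4 * C / (c * e * p) \<le> \<alpha>" using \<alpha> by (simp add: \<alpha>1_def)
      then have "C \<le> u * (e / 2 * p)" using c e p by (simp add: u_def field_simps)
      also have "\<dots> \<le> exp u * (e / 2 * p)" using e p by (intro mult_right_mono le_exp) auto
      finally have "exp (- \<alpha> * (f xstar + c)) * C \<le> exp (- \<alpha> * (f xstar + c)) * (exp u * (e / 2 * p))"
        by simp
      also have "\<dots> = exp (- \<alpha> * (f xstar + c) + u) * (e / 2 * p)" by (simp only: exp_add mult.assoc)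
      also have "- \<alpha> * (f xstar + c) + u = - \<alpha> * (f xstar + c / 2)" by (simp add: u_def field_simps)
      finally show ?thesis by (simp add: mult.commute mult.left_commute)
    qed
    also have "\<dots> \<le> e / 2 * Z" using Zl e by (intro mult_left_mono) auto
    finally show ?thesis using Z_def by simp
  qed
  then show ?thesis using \<alpha>1 unfolding G_def by blast
qed

text \<open>The quotient of two Gaussian densities of equal variance is the exponential of an affine
  function. Splitting it at an arbitrary \<open>y\<close> isolates a constant, which cancels from
  vanishing integrals, and leaves a factor controlled by the distance to \<open>y\<close>.\<close>

lemma gaussian_change_mean:
  fixes m n y :: "'a::euclidean_space"
  assumes "s > 0"
  shows "gaussian n s = density (gaussian m s)
    (\<lambda>x. ennreal (exp ((m \<bullet> m - n \<bullet> n) / (2 * s\<^sup>2) - y \<bullet> (m - n) / s\<^sup>2) * exp (- ((x - y) \<bullet> (m - n)) / s\<^sup>2)))"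
proof -
  have dens: "(\<Prod>b\<in>Basis. normal_density (m \<bullet> b) s (x \<bullet> b)) *
      (exp ((m \<bullet> m - n \<bullet> n) / (2 * s\<^sup>2) - y \<bullet> (m - n) / s\<^sup>2) * exp (- ((x - y) \<bullet> (m - n)) / s\<^sup>2)) =
    (\<Prod>b\<in>Basis. normal_density (n \<bullet> b) s (x \<bullet> b))" for x
  proof -
    have 1: "normal_density (n \<bullet> b) s (x \<bullet> b) = normal_density (m \<bullet> b) s (x \<bullet> b) *
        exp (((m \<bullet> b) * (m \<bullet> b) - (n \<bullet> b) * (n \<bullet> b)) / (2 * s\<^sup>2) - (x \<bullet> b) * (m \<bullet> b - n \<bullet> b) / s\<^sup>2)" for b
    proof -
      have "- (x \<bullet> b - n \<bullet> b)\<^sup>2 / (2 * s\<^sup>2) = - (x \<bullet> b - m \<bullet> b)\<^sup>2 / (2 * s\<^sup>2) +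
        (((m \<bullet> b) * (m \<bullet> b) - (n \<bullet> b) * (n \<bullet> b)) / (2 * s\<^sup>2) - (x \<bullet> b) * (m \<bullet> b - n \<bullet> b) / s\<^sup>2)"
        using assms by (simp add: field_simps power2_diff) (simp add: power2_eq_square algebra_simps)
      then show ?thesis by (simp add: normal_density_def exp_add[symmetric])
    qed
    have "(\<Sum>b\<in>Basis. ((m \<bullet> b) * (m \<bullet> b) - (n \<bullet> b) * (n \<bullet> b)) / (2 * s\<^sup>2) - (x \<bullet> b) * (m \<bullet> b - n \<bullet> b) / s\<^sup>2)
       = (m \<bullet> m - n \<bullet> n) / (2 * s\<^sup>2) - x \<bullet> (m - n) / s\<^sup>2"
      unfolding euclidean_inner[of m m] euclidean_inner[of n n] euclidean_inner[of x "m - n"]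
      by (simp add: sum_subtractf sum_divide_distrib[symmetric] inner_diff_left)
    also have "\<dots> = ((m \<bullet> m - n \<bullet> n) / (2 * s\<^sup>2) - y \<bullet> (m - n) / s\<^sup>2) + (- ((x - y) \<bullet> (m - n)) / s\<^sup>2)"
      by (simp add: inner_diff_left diff_divide_distrib)
    finally show ?thesis
      unfolding 1 prod.distrib by (simp add: exp_sum[symmetric] exp_add[symmetric])
  qed
  have dens': "ennreal (\<Prod>b\<in>Basis. normal_density (m \<bullet> b) s (x \<bullet> b)) *
      ennreal (exp ((m \<bullet> m - n \<bullet> n) / (2 * s\<^sup>2) - y \<bullet> (m - n) / s\<^sup>2) * exp (- ((x - y) \<bullet> (m - n)) / s\<^sup>2)) =
    ennreal (\<Prod>b\<in>Basis. normal_density (n \<bullet> b) s (x \<bullet> b))" for x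
    by (subst ennreal_mult[symmetric]) (simp_all only: dens prod_nonneg normal_density_nonneg
        zero_le_mult_iff exp_ge_zero simp_thms)
  show ?thesis
    unfolding gaussian_def
    by (subst density_density_eq) (measurable, simp only: dens' )
qed

text \<open>Measures how far a density ratio is from 1: the linear factor will carry |m - n|, and
  the exponential factor is absorbed by the weight in \<open>laplace_concentration\<close>.\<close>

lemma abs_one_minus_exp_le: "\<bar>1 - exp (- u)\<bar> \<le> \<bar>u\<bar> * exp \<bar>u\<bar>" for u :: real
proof (cases "u \<ge> 0")
  case True
  have "1 - u \<le> exp (- u)" using exp_ge_add_one_self[of "- u"] by simp
  moreover have "u * 1 \<le> u * exp u" using True by (intro mult_left_mono) auto
  moreover have "exp (- u) \<le> 1" using True by simp
  ultimately show ?thesis using True by simp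
next
  case False
  have "1 + u \<le> exp u" by simp
  then have "exp (- u) * (1 + u) \<le> exp (- u) * exp u" by (intro mult_left_mono) auto
  then have "exp (- u) - 1 \<le> - u * exp (- u)" by (simp add: exp_add[symmetric] algebra_simps)
  moreover have "1 \<le> exp (- u)" using False by simp
  ultimately show ?thesis using False by simp
qed

text \<open>The derivative of \<open>m \<mapsto> X\<^sup>\<alpha>(N(m, s\<^sup>2 I))\<close> is the covariance of the concentrating measure divided by
  \<open>s\<^sup>2\<close>; instead of differentiating, the proof compares two means directly: with \<open>y = X\<^sup>\<alpha>(N(n, s\<^sup>2 I))\<close>, the
  vanishing integral of \<open>exp (- \<alpha> f) (x - y)\<close> under \<open>N(n, s\<^sup>2 I)\<close> is rewritten as one under \<open>N(m, s\<^sup>2 I)\<close>.\<close>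

lemma consensus_point_contraction:
  fixes f :: "'a::euclidean_space \<Rightarrow> real"
  assumes s: "s > 0" and fc: "continuous_on UNIV f" and min: "\<And>x. f xstar \<le> f x"
    and sep: "\<forall>r>0. \<exists>c>0. \<forall>x. norm (x - xstar) \<ge> r \<longrightarrow> f xstar + c \<le> f x"
    and R: "R > 0" and \<eta>: "\<eta> > 0"
  shows "\<exists>\<alpha>1>0. \<forall>\<alpha>\<ge>\<alpha>1.
     (\<forall>m. norm m \<le> R \<longrightarrow> norm (consensus_point f \<alpha> (gaussian m s) - xstar) \<le> \<eta>) \<and>
     (\<forall>m n. norm m \<le> R \<longrightarrow> norm n \<le> R \<longrightarrow>
        norm (consensus_point f \<alpha> (gaussian m s) - consensus_point f \<alpha> (gaussian n s)) \<le> norm (m - n) / 2)"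
proof -
  have [measurable]: "f \<in> borel_measurable borel" using fc by (rule borel_measurable_continuous_onI)
  \<comment> \<open>The value 1 gives \<open>norm (x - T n) \<le> 1 + d\<close>,
    \<open>\<eta>\<close> is the requested concentration, and \<open>s\<^sup>2 / 2\<close> cancels
    the factor \<open>1 / s\<^sup>2\<close> of the density ratio, leaving the contraction factor
    1/2.\<close>
  define e where "e = Min {1, \<eta>, s\<^sup>2 / 2}"
  have e: "e > 0" "e \<le> 1" "e \<le> \<eta>" "e \<le> s\<^sup>2 / 2" using s \<eta> by (auto simp: e_def)
  \<comment> \<open>\<open>2 * R / s\<^sup>2\<close> bounds the exponent of the density ratio per
    unit distance from \<open>xstar\<close>, as \<open>norm (m - n) \<le> 2 * R\<close>; the extra 1
    absorbs \<open>norm (x - T n) \<le> exp d\<close>.\<close>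
  define K where "K = 2 * R / s\<^sup>2 + 1"
  have K: "K \<ge> 0" using R by (simp add: K_def)
  define G where "G = (\<lambda>x::'a. norm (x - xstar) * exp (K * norm (x - xstar)))"
  have [measurable]: "G \<in> borel_measurable borel" unfolding G_def by measurable
  have Gle: "norm (G x) \<le> exp ((K + 1) * norm xstar) * exp ((K + 1) * norm x)" for x
    unfolding G_def using exp_norm_diff_bound[OF K, of x xstar] by (simp add: abs_mult)
  obtain \<alpha>1 where \<alpha>1: "\<alpha>1 > 0" and conc: "\<And>\<alpha> m. \<alpha> \<ge> \<alpha>1 \<Longrightarrow> norm m \<le> R \<Longrightarrow>
     (\<integral>x. exp (- \<alpha> * f x) * G x \<partial>gaussian m s) \<le> e * (\<integral>x. exp (- \<alpha> * f x) \<partial>gaussian m s)"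
    using laplace_concentration[OF s fc min sep K e(1), of R] unfolding G_def by blast
  have main: "norm (consensus_point f \<alpha> (gaussian m s) - xstar) \<le> e \<and>
      (norm n \<le> R \<longrightarrow> norm (consensus_point f \<alpha> (gaussian m s) - consensus_point f \<alpha> (gaussian n s)) \<le> norm (m - n) / 2)"
    if \<alpha>: "\<alpha> \<ge> \<alpha>1" and m: "norm m \<le> R" for \<alpha> m n
  proof -
    have a0: "\<alpha> > 0" using \<alpha> \<alpha>1 by simp
    define E where "E = (\<lambda>x. exp (- \<alpha> * f x))"
    define Z where "Z = (\<lambda>m. \<integral>x. E x \<partial>gaussian m s)"
    define T where "T = (\<lambda>m. consensus_point f \<alpha> (gaussian m s))"
    have [measurable]: "E \<in> borel_measurable borel" unfolding E_def by measurable
    have E0: "E x > 0" for x by (simp add: E_def)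
    have iw: "integrable (gaussian m s) (\<lambda>x. E x *\<^sub>R g x)"
      if [measurable]: "g \<in> borel_measurable borel" and "\<And>x. norm (g x) \<le> C * exp (a * norm x)"
      for m C a and g :: "'a \<Rightarrow> 'c::{banach,second_countable_topology}"
      unfolding E_def using integrable_gaussian_weighted[of s \<alpha> f g xstar C a m] s a0 min that by simp
    have iE: "integrable (gaussian m s) E" for m
      using iw[of "\<lambda>_. 1::real" 1 0 m] by simp
    have iEx: "integrable (gaussian m s) (\<lambda>x. E x *\<^sub>R x)" for m
      using iw[of "\<lambda>x. x" 1 1 m] le_exp by simp
    have iEG: "integrable (gaussian m s) (\<lambda>x. E x * G x)" for m
      using iw[of G "exp ((K + 1) * norm xstar)" "K + 1" m] Gle by simp
    have Z: "Z m > 0" for m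
    proof -
      interpret prob_space "gaussian m s" by (rule prob_space_gaussian) fact
      show ?thesis unfolding Z_def
        using integral_less_AE_space[of "\<lambda>_. 0" E] iE E0 emeasure_space_1 by simp
    qed
    have TZ: "Z m *\<^sub>R (T m - y) = (\<integral>x. E x *\<^sub>R (x - y) \<partial>gaussian m s)" for m y
    proof -
      have "Z m *\<^sub>R T m = (\<integral>x. E x *\<^sub>R x \<partial>gaussian m s)"
        using Z[of m] by (simp add: T_def consensus_point_def Z_def E_def)
      moreover have "(\<integral>x. E x *\<^sub>R (x - y) \<partial>gaussian m s)
          = (\<integral>x. E x *\<^sub>R x \<partial>gaussian m s) - Z m *\<^sub>R y"
        using iEx iE unfolding Z_def by (simp add: scaleR_diff_right)
      ultimately show ?thesis by (simp add: scaleR_diff_right)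
    qed
    have iEd: "integrable (gaussian m s) (\<lambda>x. E x *\<^sub>R (x - y))" for m y
      using iEx iE by (simp add: scaleR_diff_right)
    have conc': "(\<integral>x. E x * G x \<partial>gaussian m s) \<le> e * Z m" if "norm m \<le> R" for m
      using conc[OF \<alpha> that] by (simp add: E_def Z_def)
    have near: "norm (T m - xstar) \<le> e" if m: "norm m \<le> R" for m
    proof -
      have "Z m * norm (T m - xstar) = norm (\<integral>x. E x *\<^sub>R (x - xstar) \<partial>gaussian m s)"
        using arg_cong[OF TZ[of m xstar], of norm] Z[of m] by simp
      also have "\<dots> \<le> (\<integral>x. E x * G x \<partial>gaussian m s)"
      proof (rule Bochner_Integration.integral_norm_bound_integral[OF iEd iEG])
        fix x
        have "norm (x - xstar) * 1 \<le> G x" unfolding G_def using K by (intro mult_left_mono) auto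
        then show "norm (E x *\<^sub>R (x - xstar)) \<le> E x * G x"
          using E0[of x] by simp
      qed
      also have "\<dots> \<le> Z m * e" using conc'[OF m] by (simp add: mult.commute)
      finally show ?thesis using Z[of m] by simp
    qed
    have contr: "norm (T m - T n) \<le> norm (m - n) / 2" if n: "norm n \<le> R"
    proof -
      define h where "h = (\<lambda>x. exp (- ((x - xstar) \<bullet> (m - n)) / s\<^sup>2))"
      define \<kappa> where "\<kappa> = exp ((m \<bullet> m - n \<bullet> n) / (2 * s\<^sup>2) - xstar \<bullet> (m - n) / s\<^sup>2)"
      have k: "\<kappa> > 0" by (simp add: \<kappa>_def)
      have h0: "h x > 0" for x by (simp add: h_def)
      have [measurable]: "h \<in> borel_measurable borel" unfolding h_def by measurable
      have cm: "gaussian n s = density (gaussian m s) (\<lambda>x. ennreal (\<kappa> * h x))"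
        using gaussian_change_mean[OF s, of n m xstar] by (simp add: h_def \<kappa>_def)
      have "integrable (gaussian n s) (\<lambda>x. E x *\<^sub>R (x - T n))" by (rule iEd)
      then have ih: "integrable (gaussian m s) (\<lambda>x. (\<kappa> * h x) *\<^sub>R (E x *\<^sub>R (x - T n)))"
        unfolding cm using k h0 by (subst (asm) integrable_density) (auto simp: less_imp_le)
      have "0 = (\<integral>x. E x *\<^sub>R (x - T n) \<partial>gaussian n s)" using TZ[of n "T n"] by simp
      also have "\<dots> = (\<integral>x. (\<kappa> * h x) *\<^sub>R (E x *\<^sub>R (x - T n)) \<partial>gaussian m s)"
        unfolding cm using k h0 by (subst integral_density) (auto simp: less_imp_le)
      finally have z: "(\<integral>x. (\<kappa> * h x) *\<^sub>R (E x *\<^sub>R (x - T n)) \<partial>gaussian m s) = 0" by simp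
      have ih': "integrable (gaussian m s) (\<lambda>x. h x *\<^sub>R (E x *\<^sub>R (x - T n)))"
        using integrable_scaleR_right[OF ih, of "1 / \<kappa>"] k by simp
      \<comment> \<open>Because the integral vanishes, the positive constant \<open>\<kappa>\<close>
        can be divided out and never has to be estimated.\<close>
      have z': "(\<integral>x. h x *\<^sub>R (E x *\<^sub>R (x - T n)) \<partial>gaussian m s) = 0"
        using z k by (simp flip: scaleR_scaleR)
      \<comment> \<open>Subtracting the zero integral leaves the factor \<open>1 - h x\<close>,
        which is of first order in \<open>m - n\<close>; this produces the Lipschitz bound.\<close>
      have "Z m *\<^sub>R (T m - T n) = (\<integral>x. E x *\<^sub>R (x - T n) - h x *\<^sub>R (E x *\<^sub>R (x - T n)) \<partial>gaussian m s)"
        using TZ[of m "T n"] z' iEd ih' by simp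
      then have "Z m * norm (T m - T n)
          = norm (\<integral>x. E x *\<^sub>R (x - T n) - h x *\<^sub>R (E x *\<^sub>R (x - T n)) \<partial>gaussian m s)"
        using Z[of m] by (metis abs_of_pos norm_scaleR)
      also have "\<dots> \<le> (\<integral>x. norm (m - n) / s\<^sup>2 * (E x * G x) \<partial>gaussian m s)"
      proof (rule Bochner_Integration.integral_norm_bound_integral)
        show "integrable (gaussian m s) (\<lambda>x. E x *\<^sub>R (x - T n) - h x *\<^sub>R (E x *\<^sub>R (x - T n)))"
          using iEd ih' by (rule Bochner_Integration.integrable_diff)
        show "integrable (gaussian m s) (\<lambda>x. norm (m - n) / s\<^sup>2 * (E x * G x))"
          using iEG by (rule integrable_mult_right)
        fix x
        define u where "u = ((x - xstar) \<bullet> (m - n)) / s\<^sup>2"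
        define d where "d = norm (x - xstar)"
        have u1: "\<bar>u\<bar> \<le> d * (norm (m - n) / s\<^sup>2)"
          using Cauchy_Schwarz_ineq2[of "x - xstar" "m - n"] s
          by (simp add: u_def d_def divide_right_mono)
        have "norm (m - n) \<le> 2 * R" using norm_triangle_ineq4[of m n] m n by simp
        then have "d * (norm (m - n) / s\<^sup>2) \<le> d * (2 * R / s\<^sup>2)"
          using s by (intro mult_left_mono divide_right_mono) (auto simp: d_def)
        then have u2: "\<bar>u\<bar> \<le> 2 * R / s\<^sup>2 * d" using u1 by (simp add: mult.commute)
        have "norm (x - T n) \<le> d + norm (T n - xstar)"
          using norm_triangle_ineq4[of "x - xstar" "T n - xstar"] by (simp add: d_def)
        also have "\<dots> \<le> 1 + d" using near[OF n] e by simp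
        also have "\<dots> \<le> exp d" by simp
        finally have xd: "norm (x - T n) \<le> exp d" .
        have "\<bar>1 - h x\<bar> \<le> \<bar>u\<bar> * exp \<bar>u\<bar>"
          using abs_one_minus_exp_le[of u] by (simp add: h_def u_def)
        also have "\<dots> \<le> (d * (norm (m - n) / s\<^sup>2)) * exp (2 * R / s\<^sup>2 * d)"
          using u1 u2 by (intro mult_mono) (auto simp: d_def)
        finally have "\<bar>1 - h x\<bar> * norm (x - T n)
            \<le> ((d * (norm (m - n) / s\<^sup>2)) * exp (2 * R / s\<^sup>2 * d)) * exp d"
          using xd by (intro mult_mono) (auto simp: d_def)
        also have "\<dots> = norm (m - n) / s\<^sup>2 * G x"
          by (simp add: G_def d_def[symmetric] K_def exp_add[symmetric] distrib_right mult.assoc)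
        finally have b: "\<bar>1 - h x\<bar> * norm (x - T n) \<le> norm (m - n) / s\<^sup>2 * G x" .
        have "E x *\<^sub>R (x - T n) - h x *\<^sub>R (E x *\<^sub>R (x - T n)) = (E x * (1 - h x)) *\<^sub>R (x - T n)"
          by (simp add: algebra_simps)
        then have "norm (E x *\<^sub>R (x - T n) - h x *\<^sub>R (E x *\<^sub>R (x - T n)))
            = E x * (\<bar>1 - h x\<bar> * norm (x - T n))"
          using E0[of x] by (simp add: abs_mult)
        also have "\<dots> \<le> E x * (norm (m - n) / s\<^sup>2 * G x)"
          using b E0[of x] by (intro mult_left_mono) auto
        finally show "norm (E x *\<^sub>R (x - T n) - h x *\<^sub>R (E x *\<^sub>R (x - T n)))
            \<le> norm (m - n) / s\<^sup>2 * (E x * G x)" by (simp add: mult.left_commute)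
      qed
      also have "\<dots> = norm (m - n) / s\<^sup>2 * (\<integral>x. E x * G x \<partial>gaussian m s)" by simp
      also have "\<dots> \<le> norm (m - n) / s\<^sup>2 * (s\<^sup>2 / 2 * Z m)"
      proof (intro mult_left_mono)
        have "e * Z m \<le> s\<^sup>2 / 2 * Z m" using e Z[of m] by (intro mult_right_mono) auto
        then show "(\<integral>x. E x * G x \<partial>gaussian m s) \<le> s\<^sup>2 / 2 * Z m" using conc'[OF m] by linarith
      qed auto
      also have "\<dots> = Z m * (norm (m - n) / 2)" using s by simp
      finally show ?thesis using Z[of m] by simp
    qed
    show ?thesis using near[OF m] contr by (simp add: T_def)
  qed
  show ?thesis
    using \<alpha>1 main e(3) by (intro exI[of _ \<alpha>1]) (meson order_trans order_refl)
qed

section \<open>Ornstein-Uhlenbeck processes\<close>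

text \<open>No stochastic integral is needed: the equation \<open>dY = - \<kappa> Y dt + dN\<close> is solved path by path. The
  error on one subinterval \<open>[u, v]\<close> is \<open>\<kappa>\<close> times the integral over \<open>[u, v]\<close> of
  \<open>\<psi>(r) Y(v) - \<psi>(u) Y(r)\<close>, where \<open>\<psi>(r) = exp (- \<kappa> (t - r))\<close>.\<close>

lemma exponential_Euler_limit:
  fixes Y N :: "real \<Rightarrow> 'a::euclidean_space"
  assumes t: "t > 0" and \<kappa>: "\<kappa> > 0" and Yc: "continuous_on {0..t} Y"
    and eq: "\<And>b. b \<in> {0..t} \<Longrightarrow> Y b = Y 0 - \<kappa> *\<^sub>R integral {0..b} Y + (N b - N 0)"
  shows "(\<lambda>n. exp (- \<kappa> * t) *\<^sub>R Y 0 + (\<Sum>j<n. exp (- \<kappa> * (t - real j * t / real n)) *\<^sub>R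
           (N (real (Suc j) * t / real n) - N (real j * t / real n)))) \<longlonglongrightarrow> Y t"
proof (rule LIMSEQ_I)
  fix e :: real assume e: "e > 0"
  define \<psi> where "\<psi> = (\<lambda>r. exp (- \<kappa> * (t - r)))"
  \<comment> \<open>The n step errors of size \<open>\<kappa> * \<epsilon> * (t / real n)\<close>
    then add up to \<open>e / 2\<close>.\<close>
  define \<epsilon> where "\<epsilon> = e / (2 * \<kappa> * t)"
  have \<epsilon>: "\<epsilon> > 0" using e \<kappa> t by (simp add: \<epsilon>_def)
  \<comment> \<open>The integrand of the error compares the arguments (r, v) and (u, r), so uniform
    continuity is needed jointly. Each coordinate moves by at most \<open>v - u\<close>; the factor
    2 in the mesh condition covers both.\<close>
  have "continuous_on ({0..t} \<times> {0..t}) (\<lambda>p. \<psi> (fst p) *\<^sub>R Y (snd p))"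
    unfolding \<psi>_def
    by (intro continuous_intros continuous_on_compose2[OF Yc]) auto
  then have "uniformly_continuous_on ({0..t} \<times> {0..t}) (\<lambda>p. \<psi> (fst p) *\<^sub>R Y (snd p))"
    by (intro compact_uniformly_continuous compact_Times) auto
  then obtain d where d: "d > 0" "\<And>p p'. p \<in> {0..t} \<times> {0..t} \<Longrightarrow> p' \<in> {0..t} \<times> {0..t} \<Longrightarrow> dist p' p < d \<Longrightarrow>
      dist (\<psi> (fst p') *\<^sub>R Y (snd p')) (\<psi> (fst p) *\<^sub>R Y (snd p)) < \<epsilon>"
    using \<epsilon> unfolding uniformly_continuous_on_def by metis
  have step: "norm (\<psi> v *\<^sub>R Y v - \<psi> u *\<^sub>R Y u - \<psi> u *\<^sub>R (N v - N u)) \<le> \<kappa> * \<epsilon> * (v - u)"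
    if uv: "0 \<le> u" "u \<le> v" "v \<le> t" "2 * (v - u) < d" for u v
  proof -
    have Yi: "Y integrable_on {a..b}" if "0 \<le> a" "b \<le> t" for a b
      by (rule integrable_continuous_interval, rule continuous_on_subset[OF Yc]) (use that in auto)
    have split: "integral {0..v} Y = integral {0..u} Y + integral {u..v} Y"
      using uv Yi by (intro Henstock_Kurzweil_Integration.integral_combine[symmetric]) auto
    have Yu: "Y u = Y 0 - \<kappa> *\<^sub>R integral {0..u} Y + (N u - N 0)"
      and Yv: "Y v = Y 0 - \<kappa> *\<^sub>R integral {0..v} Y + (N v - N 0)"
      by (rule eq; use uv in simp)+
    have dY: "Y v - Y u = - \<kappa> *\<^sub>R integral {u..v} Y + (N v - N u)"
      unfolding Yu Yv split by (simp add: algebra_simps)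
    \<comment> \<open>As \<open>\<psi>\<close> has derivative \<open>\<kappa> * \<psi>\<close>, its
      increment times \<open>Y v\<close> is itself an integral over [u, v] and merges with the drift
      term.\<close>
    have "((\<lambda>r. \<kappa> * \<psi> r) has_integral (\<psi> v - \<psi> u)) {u..v}"
      unfolding \<psi>_def
      by (rule fundamental_theorem_of_calculus[OF uv(2)])
         (auto intro!: derivative_eq_intros simp flip: has_real_derivative_iff_has_vector_derivative)
    then have "((\<lambda>r. (\<kappa> * \<psi> r) *\<^sub>R Y v) has_integral (\<psi> v - \<psi> u) *\<^sub>R Y v) {u..v}"
      by (rule has_integral_scaleR_left)
    moreover have "((\<lambda>r. (\<kappa> * \<psi> u) *\<^sub>R Y r) has_integral (\<kappa> * \<psi> u) *\<^sub>R integral {u..v} Y) {u..v}"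
      using Yi[of u v] uv by (intro has_integral_cmul integrable_integral) auto
    ultimately have "((\<lambda>r. (\<kappa> * \<psi> r) *\<^sub>R Y v - (\<kappa> * \<psi> u) *\<^sub>R Y r) has_integral
        ((\<psi> v - \<psi> u) *\<^sub>R Y v - (\<kappa> * \<psi> u) *\<^sub>R integral {u..v} Y)) {u..v}"
      by (rule has_integral_diff)
    moreover have "\<psi> v *\<^sub>R Y v - \<psi> u *\<^sub>R Y u - \<psi> u *\<^sub>R (N v - N u)
        = (\<psi> v - \<psi> u) *\<^sub>R Y v - (\<kappa> * \<psi> u) *\<^sub>R integral {u..v} Y"
    proof -
      have dN: "N v - N u = Y v - Y u + \<kappa> *\<^sub>R integral {u..v} Y" using dY by simp
      show ?thesis unfolding dN by (simp add: algebra_simps)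
    qed
    ultimately have I: "((\<lambda>r. (\<kappa> * \<psi> r) *\<^sub>R Y v - (\<kappa> * \<psi> u) *\<^sub>R Y r) has_integral
        (\<psi> v *\<^sub>R Y v - \<psi> u *\<^sub>R Y u - \<psi> u *\<^sub>R (N v - N u))) (cbox u v)" by simp
    have "norm (\<psi> v *\<^sub>R Y v - \<psi> u *\<^sub>R Y u - \<psi> u *\<^sub>R (N v - N u))
        \<le> \<kappa> * \<epsilon> * Henstock_Kurzweil_Integration.content (cbox u v)"
    proof (rule has_integral_bound[OF _ I])
      fix r assume r: "r \<in> cbox u v"
      have "dist (r, v) (u, r) \<le> dist r u + dist v r"
        unfolding dist_Pair_Pair by (rule sqrt_sum_squares_le_sum) auto
      also have "\<dots> < d" using r uv by (auto simp: dist_real_def)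
      finally have "dist (\<psi> r *\<^sub>R Y v) (\<psi> u *\<^sub>R Y r) < \<epsilon>"
        using d(2)[of "(u, r)" "(r, v)"] r uv by auto
      then have "\<kappa> * norm (\<psi> r *\<^sub>R Y v - \<psi> u *\<^sub>R Y r) \<le> \<kappa> * \<epsilon>"
        using \<kappa> by (simp add: dist_norm)
      moreover have "(\<kappa> * \<psi> r) *\<^sub>R Y v - (\<kappa> * \<psi> u) *\<^sub>R Y r = \<kappa> *\<^sub>R (\<psi> r *\<^sub>R Y v - \<psi> u *\<^sub>R Y r)"
        by (simp add: algebra_simps)
      ultimately show "norm ((\<kappa> * \<psi> r) *\<^sub>R Y v - (\<kappa> * \<psi> u) *\<^sub>R Y r) \<le> \<kappa> * \<epsilon>"
        using \<kappa> by simp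
    qed (use \<kappa> \<epsilon> in simp)
    then show ?thesis using uv by simp
  qed
  obtain n0 where n0: "2 * t / d < real n0" using reals_Archimedean2 by blast
  have n0pos: "real n0 > 0" using n0 t d(1) by (meson divide_pos_pos less_trans mult_pos_pos zero_less_numeral)
  show "\<exists>n0. \<forall>n\<ge>n0. norm (exp (- \<kappa> * t) *\<^sub>R Y 0 + (\<Sum>j<n. exp (- \<kappa> * (t - real j * t / real n)) *\<^sub>R
           (N (real (Suc j) * t / real n) - N (real j * t / real n))) - Y t) < e"
  proof (intro exI allI impI)
    fix n assume n: "n0 \<le> n"
    then have np: "real n > 0" using n0pos by linarith
    define \<tau> where "\<tau> = (\<lambda>j::nat. real j * t / real n)"
    have "2 * t / d < real n" using n0 n by linarith
    then have mesh: "2 * (t / real n) < d" using np d(1) by (simp add: field_simps)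
    have \<tau>Suc: "\<tau> (Suc j) = \<tau> j + t / real n" for j by (simp add: \<tau>_def add_divide_distrib distrib_right)
    have \<tau>le: "\<tau> (Suc j) \<le> t" if "j < n" for j
    proof -
      have "real (Suc j) * t \<le> real n * t" using that t by (intro mult_right_mono) auto
      then show ?thesis using np by (simp add: \<tau>_def field_simps)
    qed
    have \<tau>0: "\<tau> j \<ge> 0" for j using t np by (simp add: \<tau>_def)
    \<comment> \<open>In this telescoping sum \<open>\<psi>\<close> is 1 at the last grid point,
      which is \<open>t\<close> because \<open>n\<close> is positive, and
      \<open>exp (- \<kappa> * t)\<close> at 0.\<close>
    have "Y t - exp (- \<kappa> * t) *\<^sub>R Y 0 = (\<Sum>j<n. \<psi> (\<tau> (Suc j)) *\<^sub>R Y (\<tau> (Suc j)) - \<psi> (\<tau> j) *\<^sub>R Y (\<tau> j))"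
      using np by (subst sum_lessThan_telescope) (simp add: \<tau>_def \<psi>_def)
    then have D: "Y t - (exp (- \<kappa> * t) *\<^sub>R Y 0 + (\<Sum>j<n. \<psi> (\<tau> j) *\<^sub>R (N (\<tau> (Suc j)) - N (\<tau> j))))
        = (\<Sum>j<n. \<psi> (\<tau> (Suc j)) *\<^sub>R Y (\<tau> (Suc j)) - \<psi> (\<tau> j) *\<^sub>R Y (\<tau> j)
             - \<psi> (\<tau> j) *\<^sub>R (N (\<tau> (Suc j)) - N (\<tau> j)))" (is "?D = _")
      by (simp add: sum_subtractf)
    have "norm ?D \<le> (\<Sum>j<n. \<kappa> * \<epsilon> * (t / real n))"
      unfolding D
    proof (rule sum_norm_le)
      fix j assume "j \<in> {..<n}"
      then show "norm (\<psi> (\<tau> (Suc j)) *\<^sub>R Y (\<tau> (Suc j)) - \<psi> (\<tau> j) *\<^sub>R Y (\<tau> j)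
             - \<psi> (\<tau> j) *\<^sub>R (N (\<tau> (Suc j)) - N (\<tau> j))) \<le> \<kappa> * \<epsilon> * (t / real n)"
        using step[of "\<tau> j" "\<tau> (Suc j)"] \<tau>0[of j] \<tau>le[of j] mesh t np unfolding \<tau>Suc by simp
    qed
    also have "\<dots> = e / 2" using np \<kappa> t by (simp add: \<epsilon>_def)
    also have "\<dots> < e" using e by simp
    finally show "norm (exp (- \<kappa> * t) *\<^sub>R Y 0 + (\<Sum>j<n. exp (- \<kappa> * (t - real j * t / real n)) *\<^sub>R
           (N (real (Suc j) * t / real n) - N (real j * t / real n))) - Y t) < e"
      by (simp add: norm_minus_commute \<psi>_def \<tau>_def)
  qed
qed

section \<open>Sums of independent Gaussians and independence of path functionals\<close>

lemma (in prob_space) indep_vars_sum_vector: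
  fixes X :: "'i \<Rightarrow> 'a \<Rightarrow> 'b::euclidean_space"
  assumes I: "finite I" "i \<notin> I" and indep: "indep_vars (\<lambda>_. borel) X (insert i I)"
  shows "indep_var borel (\<lambda>\<omega>. \<Sum>i\<in>I. X i \<omega>) borel (X i)"
proof -
  have "indep_var
    borel ((\<lambda>f. \<Sum>i\<in>I. f i) \<circ> (\<lambda>\<omega>. restrict (\<lambda>i. X i \<omega>) I))
    borel ((\<lambda>f. f i) \<circ> (\<lambda>\<omega>. restrict (\<lambda>i. X i \<omega>) {i}))"
    using I by (intro indep_var_compose[OF indep_var_restrict[OF indep]]) auto
  then show ?thesis by (simp add: comp_def)
qed

lemma (in prob_space) distr_scaleR_gaussian:
  assumes [measurable]: "X \<in> borel_measurable M" and "distr M borel X = gaussian (0::'b::euclidean_space) s"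
    and "s > 0" "a > 0"
  shows "distr M borel (\<lambda>\<omega>. a *\<^sub>R X \<omega>) = gaussian 0 (a * s)"
proof -
  have "distr M borel (\<lambda>\<omega>. a *\<^sub>R X \<omega>) = distr (distr M borel X) borel (\<lambda>x. 0 + a *\<^sub>R x)"
    by (subst distr_distr) (auto simp: comp_def)
  then show ?thesis using assms distr_gaussian_affine[of s a 0 0] by simp
qed

text \<open>The induction starts at 1, since the empty sum has a point mass as its law. In the step,
  the partial sum and the next summand depend on disjoint index sets of the family.\<close>

lemma (in prob_space) distr_sum_gaussian:
  fixes D :: "nat \<Rightarrow> 'a \<Rightarrow> 'b::euclidean_space"
  assumes "n > 0" and "indep_vars (\<lambda>_. borel) D {..<n}"
    and "\<And>j. j < n \<Longrightarrow> distr M borel (D j) = gaussian 0 (s j)" and "\<And>j. j < n \<Longrightarrow> s j > 0"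
  shows "distr M borel (\<lambda>\<omega>. \<Sum>j<n. D j \<omega>) = gaussian 0 (sqrt (\<Sum>j<n. (s j)\<^sup>2))"
  using assms
proof (induction n rule: nat_induct_non_zero)
  case 1
  then show ?case by simp
next
  case (Suc n)
  have ind: "indep_vars (\<lambda>_. borel) D {..<n}"
    using Suc.prems(1) by (rule indep_vars_subset) auto
  have IH: "distr M borel (\<lambda>\<omega>. \<Sum>j<n. D j \<omega>) = gaussian 0 (sqrt (\<Sum>j<n. (s j)\<^sup>2))"
    using Suc.IH[OF ind] Suc.prems(2,3) by simp
  have pos: "(\<Sum>j<n. (s j)\<^sup>2) > 0"
    using Suc.hyps Suc.prems(3) by (intro sum_pos zero_less_power) auto
  have "indep_var borel (\<lambda>\<omega>. \<Sum>j<n. D j \<omega>) borel (D n)"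
    using Suc.prems(1) by (intro indep_vars_sum_vector) (auto simp: lessThan_Suc)
  from distr_add_gaussian[OF this _ _ IH Suc.prems(2)[of n]]
  show ?case using pos Suc.prems(3)[of n] by simp
qed

text \<open>Preimages under the composition are preimages under \<open>X\<close>, so passing to a
  function of \<open>X\<close> can only shrink the generated sigma-algebra; independence is
  inherited.\<close>

lemma sigma_sets_compose_subset_vimage_algebra:
  assumes X: "X \<in> measurable M S" and f: "f \<in> measurable S N"
  shows "sigma_sets (space M) {(\<lambda>\<omega>. f (X \<omega>)) -` A \<inter> space M |A. A \<in> sets N}
    \<subseteq> sets (vimage_algebra (space M) X S)"
  unfolding sets_vimage_algebra
proof (rule sigma_sets_subseteq, safe)
  fix A assume "A \<in> sets N"
  then have "f -` A \<inter> space S \<in> sets S" using f by (rule measurable_sets[rotated])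
  moreover have "(\<lambda>\<omega>. f (X \<omega>)) -` A \<inter> space M = X -` (f -` A \<inter> space S) \<inter> space M"
    using measurable_space[OF X] by auto
  ultimately show "\<exists>B. (\<lambda>\<omega>. f (X \<omega>)) -` A \<inter> space M = X -` B \<inter> space M \<and> B \<in> sets S" by blast
qed

text \<open>Independence is given between the initial value and the whole noise path; this restricts
  it to the functionals that occur, the centred initial value and finite sums of increments.\<close>

lemma (in prob_space) indep_var_compose_vimage_algebras:
  assumes X: "X \<in> measurable M S" "f \<in> measurable S N1" and Y: "Y \<in> measurable M T" "g \<in> measurable T N2"
    and ind: "indep_set (sets (vimage_algebra (space M) X S)) (sets (vimage_algebra (space M) Y T))"
  shows "indep_var N1 (\<lambda>\<omega>. f (X \<omega>)) N2 (\<lambda>\<omega>. g (Y \<omega>))"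
  unfolding indep_var_eq
  using ind sigma_sets_compose_subset_vimage_algebra[OF X] sigma_sets_compose_subset_vimage_algebra[OF Y]
    measurable_compose[OF X] measurable_compose[OF Y]
  unfolding indep_sets2_eq by blast

section \<open>From the blocks to one equation, and the law of its solution\<close>

lemma continuous_on_Icc_blocks:
  fixes h :: "real \<Rightarrow> 'a::topological_space"
  assumes "\<Delta> > 0" and "\<And>i::nat. continuous_on {real i * \<Delta>..real (Suc i) * \<Delta>} h"
  shows "continuous_on {0..real n * \<Delta>} h"
proof (induction n)
  case 0 then show ?case by simp
next
  case (Suc n)
  have "{0..real (Suc n) * \<Delta>} = {0..real n * \<Delta>} \<union> {real n * \<Delta>..real (Suc n) * \<Delta>}"
    using assms(1) by (intro ivl_disj_un_two_touch(4)[symmetric]) auto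
  then show ?case
    using continuous_on_closed_Un[OF _ _ Suc assms(2)[of n]] by simp
qed

text \<open>The given equation restarts at every grid point, whereas
  \<open>exponential_Euler_limit\<close> needs a single one from time 0. The integrals add up over
  the blocks and the noise increments telescope.\<close>

lemma integral_equation_blocks:
  fixes Y N :: "real \<Rightarrow> 'a::euclidean_space"
  assumes \<Delta>: "\<Delta> > 0" and Yc: "\<And>n. continuous_on {0..real n * \<Delta>} Y"
    and eq: "\<And>i b. b \<in> {real i * \<Delta>..real (Suc i) * \<Delta>} \<Longrightarrow>
      Y b = Y (real i * \<Delta>) - \<kappa> *\<^sub>R integral {real i * \<Delta>..b} Y + (N b - N (real i * \<Delta>))"
  shows "b \<in> {0..real n * \<Delta>} \<Longrightarrow> Y b = Y 0 - \<kappa> *\<^sub>R integral {0..b} Y + (N b - N 0)"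
proof (induction n arbitrary: b)
  case 0
  then show ?case by simp
next
  case (Suc n)
  show ?case
  proof (cases "b \<le> real n * \<Delta>")
    case True then show ?thesis by (intro Suc.IH) (use Suc.prems in simp)
  next
    case False
    have n0: "real n * \<Delta> \<ge> 0" using \<Delta> by simp
    have split: "integral {0..b} Y = integral {0..real n * \<Delta>} Y + integral {real n * \<Delta>..b} Y"
      using False n0
      by (intro Henstock_Kurzweil_Integration.integral_combine[symmetric] integrable_continuous_interval
          continuous_on_subset[OF Yc[of "Suc n"]]) (use Suc.prems in auto)
    have Yb: "Y b = Y (real n * \<Delta>) - \<kappa> *\<^sub>R integral {real n * \<Delta>..b} Y + (N b - N (real n * \<Delta>))"
      by (rule eq) (use Suc.prems False in simp)
    have Yn: "Y (real n * \<Delta>) = Y 0 - \<kappa> *\<^sub>R integral {0..real n * \<Delta>} Y + (N (real n * \<Delta>) - N 0)"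
      by (rule Suc.IH) (use n0 in simp)
    show ?thesis
      unfolding Yb Yn split by (simp add: algebra_simps)
  qed
qed

text \<open>Each approximating sum is Gaussian, being a scaled initial value plus an independent sum
  of independent scaled increments. The relation \<open>var\<close> makes \<open>s\<^sup>2\<close>
  the stationary variance, so the variances converge to it and the almost sure limit inherits the
  law. The premise \<open>lim\<close> is what \<open>exponential_Euler_limit\<close> provides path
  by path.\<close>

lemma law_of_OU:
  fixes B :: "real \<Rightarrow> 'w \<Rightarrow> 'a::euclidean_space"
  assumes BM: "brownian_motion M B"
    and [measurable]: "Y0 \<in> borel_measurable M" "Yt \<in> borel_measurable M"
    and law0: "distr M borel Y0 = gaussian 0 s"
    and ind: "\<And>F. F \<in> measurable (PiM {0..} (\<lambda>_. borel)) borel \<Longrightarrow>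
      prob_space.indep_var M borel Y0 borel (\<lambda>\<omega>. F (\<lambda>t\<in>{0..}. B t \<omega>) :: 'a)"
    and pos: "\<kappa> > 0" "\<nu> > 0" "s > 0" "t > 0" and var: "\<nu>\<^sup>2 = 2 * \<kappa> * s\<^sup>2"
    and lim: "AE \<omega> in M. (\<lambda>n. exp (- \<kappa> * t) *\<^sub>R Y0 \<omega> +
      (\<Sum>j<n. exp (- \<kappa> * (t - real j * t / real n)) *\<^sub>R
         (\<nu> *\<^sub>R B (real (Suc j) * t / real n) \<omega> - \<nu> *\<^sub>R B (real j * t / real n) \<omega>))) \<longlonglongrightarrow> Yt \<omega>"
  shows "distr M borel Yt = gaussian 0 s"
proof -
  interpret prob_space M using BM by (simp add: brownian_motion_def)
  have Bm: "B r \<in> borel_measurable M" if "r \<ge> 0" for r using BM that by (simp add: brownian_motion_def)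
  define \<tau> where "\<tau> = (\<lambda>n j. real j * t / real n)"
  define \<psi> where "\<psi> = (\<lambda>n j. exp (- \<kappa> * (t - \<tau> n j)))"
  define D where "D = (\<lambda>n j \<omega>. (\<psi> n j * \<nu>) *\<^sub>R (B (\<tau> n (Suc j)) \<omega> - B (\<tau> n j) \<omega>))"
  define S where "S = (\<lambda>n \<omega>. \<Sum>j<n. D n j \<omega>)"
  define v where "v = (\<lambda>n. \<Sum>j<n. (\<psi> n j * \<nu> * sqrt (\<tau> n (Suc j) - \<tau> n j))\<^sup>2)"
  have \<tau>0: "\<tau> n j \<ge> 0" for n j using pos by (simp add: \<tau>_def)
  have [measurable]: "D n j \<in> borel_measurable M" for n j
    unfolding D_def using Bm[OF \<tau>0[of n "Suc j"]] Bm[OF \<tau>0[of n j]] by measurable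
  have [measurable]: "S n \<in> borel_measurable M" for n unfolding S_def by measurable
  have law: "distr M borel (\<lambda>\<omega>. exp (- \<kappa> * t) *\<^sub>R Y0 \<omega> + S n \<omega>)
      = gaussian 0 (sqrt ((exp (- \<kappa> * t) * s)\<^sup>2 + v n)) \<and> v n > 0" if n: "n > 0" for n
  proof -
    have \<tau>lt: "\<tau> n j < \<tau> n (Suc j)" for j
      using n pos by (simp add: \<tau>_def divide_strict_right_mono)
    have \<tau>mono: "mono (\<tau> n)" using \<tau>lt by (intro incseq_SucI) (simp add: less_imp_le)
    have "indep_vars (\<lambda>_. borel) (\<lambda>j \<omega>. B (\<tau> n (Suc j)) \<omega> - B (\<tau> n j) \<omega>) {..<n}"
      using BM \<tau>0 \<tau>mono unfolding brownian_motion_def by blast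
    then have indD: "indep_vars (\<lambda>_. borel) (D n) {..<n}"
      unfolding D_def by (rule indep_vars_compose2) auto
    have lawD: "distr M borel (D n j) = gaussian 0 (\<psi> n j * \<nu> * sqrt (\<tau> n (Suc j) - \<tau> n j))" for j
      unfolding D_def
    proof (rule distr_scaleR_gaussian)
      show "distr M borel (\<lambda>\<omega>. B (\<tau> n (Suc j)) \<omega> - B (\<tau> n j) \<omega>) = gaussian 0 (sqrt (\<tau> n (Suc j) - \<tau> n j))"
        using BM \<tau>0[of n j] \<tau>lt[of j] unfolding brownian_motion_def by blast
    qed (use Bm[OF \<tau>0] \<tau>lt[of j] pos in \<open>auto simp: \<psi>_def\<close>)
    have posD: "\<psi> n j * \<nu> * sqrt (\<tau> n (Suc j) - \<tau> n j) > 0" for j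
      using \<tau>lt[of j] pos by (simp add: \<psi>_def)
    have lawS: "distr M borel (S n) = gaussian 0 (sqrt (v n))"
      unfolding S_def v_def by (rule distr_sum_gaussian[OF n indD lawD posD])
    have v: "v n > 0"
      unfolding v_def using n posD by (intro sum_pos zero_less_power) auto
    \<comment> \<open>Exhibits \<open>S n\<close> as a measurable functional of the path on
      nonnegative times, the form to which \<open>ind\<close> applies.\<close>
    define F where "F = (\<lambda>p. \<Sum>j<n. (\<psi> n j * \<nu>) *\<^sub>R (p (\<tau> n (Suc j)) - p (\<tau> n j)) :: 'a)"
    have Fm: "F \<in> measurable (PiM {0..} (\<lambda>_. borel)) borel"
      unfolding F_def using \<tau>0
      by (intro borel_measurable_sum borel_measurable_scaleR borel_measurable_diff
          measurable_component_singleton) auto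
    have FS: "(\<lambda>\<omega>. F (\<lambda>t\<in>{0..}. B t \<omega>)) = S n"
      using \<tau>0 by (auto simp: fun_eq_iff F_def S_def D_def)
    have "indep_var borel ((\<lambda>y. exp (- \<kappa> * t) *\<^sub>R y) \<circ> Y0) borel ((\<lambda>y. y) \<circ> (\<lambda>\<omega>. F (\<lambda>t\<in>{0..}. B t \<omega>)))"
      by (rule indep_var_compose[OF ind[OF Fm]]) auto
    then have "indep_var borel (\<lambda>\<omega>. exp (- \<kappa> * t) *\<^sub>R Y0 \<omega>) borel (S n)"
      unfolding FS by (simp add: comp_def)
    from distr_add_gaussian[OF this _ _ distr_scaleR_gaussian[OF _ law0] lawS]
    show ?thesis using v pos by simp
  qed
  txt \<open>The variances need no explicit summation: they are themselves exponential Euler sums, for the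
    equation \<open>v' = - 2 \<kappa> v + \<nu>\<^sup>2\<close> with stationary solution \<open>s\<^sup>2\<close>.\<close>
  have "(\<lambda>n. exp (- (2 * \<kappa>) * t) *\<^sub>R s\<^sup>2 + (\<Sum>j<n. exp (- (2 * \<kappa>) * (t - real j * t / real n)) *\<^sub>R
           (\<nu>\<^sup>2 * (real (Suc j) * t / real n) - \<nu>\<^sup>2 * (real j * t / real n)))) \<longlonglongrightarrow> s\<^sup>2"
    by (rule exponential_Euler_limit[where Y="\<lambda>_. s\<^sup>2" and N="\<lambda>r. \<nu>\<^sup>2 * r"])
       (use pos var in auto)
  moreover have "(\<Sum>j<n. exp (- (2 * \<kappa>) * (t - real j * t / real n)) *\<^sub>R
           (\<nu>\<^sup>2 * (real (Suc j) * t / real n) - \<nu>\<^sup>2 * (real j * t / real n))) = v n" for n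
    unfolding v_def
  proof (rule sum.cong)
    fix j
    have "\<tau> n j \<le> \<tau> n (Suc j)" using pos by (simp add: \<tau>_def divide_right_mono)
    moreover have "(\<psi> n j)\<^sup>2 = exp (- (2 * \<kappa>) * (t - \<tau> n j))"
      by (simp add: \<psi>_def exp_double[symmetric] mult.assoc)
    ultimately show "exp (- (2 * \<kappa>) * (t - real j * t / real n)) *\<^sub>R
           (\<nu>\<^sup>2 * (real (Suc j) * t / real n) - \<nu>\<^sup>2 * (real j * t / real n))
        = (\<psi> n j * \<nu> * sqrt (\<tau> n (Suc j) - \<tau> n j))\<^sup>2"
      unfolding \<tau>_def[THEN fun_cong, THEN fun_cong, symmetric]
      by (simp add: power_mult_distrib right_diff_distrib mult.assoc)
  qed simp
  moreover have "exp (- (2 * \<kappa>) * t) *\<^sub>R s\<^sup>2 = (exp (- \<kappa> * t) * s)\<^sup>2"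
    by (simp add: power_mult_distrib exp_double[symmetric] mult.assoc)
  ultimately have "(\<lambda>n. (exp (- \<kappa> * t) * s)\<^sup>2 + v n) \<longlonglongrightarrow> s\<^sup>2" by simp
  then have slim: "(\<lambda>n. sqrt ((exp (- \<kappa> * t) * s)\<^sup>2 + v n)) \<longlonglongrightarrow> s"
    using tendsto_real_sqrt[of _ "s\<^sup>2"] pos by fastforce
  show ?thesis
  proof (rule distr_AE_limit_gaussian[OF _ _ _ _ _ _ slim])
    show "AE \<omega> in M. (\<lambda>n. exp (- \<kappa> * t) *\<^sub>R Y0 \<omega> + S n \<omega>) \<longlonglongrightarrow> Yt \<omega>"
      using lim by (simp add: S_def D_def \<psi>_def \<tau>_def scaleR_diff_right)
    show "\<forall>\<^sub>F n in sequentially. distr M borel (\<lambda>\<omega>. exp (- \<kappa> * t) *\<^sub>R Y0 \<omega> + S n \<omega>)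
        = gaussian 0 (sqrt ((exp (- \<kappa> * t) * s)\<^sup>2 + v n))"
      using eventually_gt_at_top[of 0] by eventually_elim (use law in blast)
    show "\<forall>\<^sub>F n in sequentially. sqrt ((exp (- \<kappa> * t) * s)\<^sup>2 + v n) > 0"
      using eventually_gt_at_top[of 0]
    proof eventually_elim
      case (elim n) then show ?case using law[of n] by (simp add: add_nonneg_pos)
    qed
  qed (use pos in auto)
qed

section \<open>Consensus Freezing and Consensus Hopping\<close>

text \<open>Subtracting from \<open>X\<close> the solution \<open>mu\<close> of the noiseless equation leaves an Ornstein-Uhlenbeck
  process, for which \<open>N(0, \<sigma>\<^sup>2 I)\<close> is stationary.\<close>

lemma consensus_freezing_law:
  fixes f :: "'a::euclidean_space \<Rightarrow> real"
  assumes pos: "lam > 0" "\<delta> > 0" "\<Delta>t > 0" "s > 0" and sigma: "\<sigma> = \<delta> / sqrt (2 * lam)"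
    and sol: "consensus_freezing_solution f lam \<delta> \<Delta>t \<alpha> s (gaussian x0 \<sigma>) M B X"
  obtains mu where "mu 0 = x0" "\<And>t. t \<ge> 0 \<Longrightarrow> law M X t = gaussian (mu t) \<sigma>"
    "\<And>i t. t \<in> {real i * \<Delta>t..real (Suc i) * \<Delta>t} \<Longrightarrow>
       mu t = consensus_point f \<alpha> (gaussian (mu (real i * \<Delta>t)) \<sigma>) + exp (- (s * lam) * (t - real i * \<Delta>t)) *\<^sub>R
         (mu (real i * \<Delta>t) - consensus_point f \<alpha> (gaussian (mu (real i * \<Delta>t)) \<sigma>))"
proof -
  define \<kappa> where "\<kappa> = s * lam"
  define \<nu> where "\<nu> = sqrt s * \<delta>"
  have \<kappa>: "\<kappa> > 0" and \<nu>: "\<nu> > 0" and \<sigma>: "\<sigma> > 0" using pos sigma by (simp_all add: \<kappa>_def \<nu>_def)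
  have var: "\<nu>\<^sup>2 = 2 * \<kappa> * \<sigma>\<^sup>2"
    using pos by (simp add: \<kappa>_def \<nu>_def sigma power_mult_distrib power_divide)
  have BM: "brownian_motion M B" and Xm: "\<And>t. t \<ge> 0 \<Longrightarrow> X t \<in> borel_measurable M"
    and law0: "law M X 0 = gaussian x0 \<sigma>"
    and ind: "prob_space.indep_set M (sets (vimage_algebra (space M) (X 0) borel))
       (sets (vimage_algebra (space M) (\<lambda>\<omega>. \<lambda>t\<in>{0..}. B t \<omega>) (PiM {0..} (\<lambda>_. borel))))"
    using sol by (auto simp: consensus_freezing_solution_def)
  interpret prob_space M using BM by (simp add: brownian_motion_def)
  have Bm: "B r \<in> borel_measurable M" if "r \<ge> 0" for r using BM that by (simp add: brownian_motion_def)
  \<comment> \<open>The consensus points are taken from the actual law of \<open>X\<close>, whose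
    Gaussian form is not yet known. They are expressed through \<open>mu\<close> only once that form
    is established, which avoids circularity.\<close>
  define c where "c = (\<lambda>i::nat. consensus_point f \<alpha> (law M X (real i * \<Delta>t)))"
  define m where "m = rec_nat x0 (\<lambda>i a. c i + exp (- \<kappa> * \<Delta>t) *\<^sub>R (a - c i))"
  define \<phi> where "\<phi> = (\<lambda>i t. c i + exp (- \<kappa> * (t - real i * \<Delta>t)) *\<^sub>R (m i - c i))"
  \<comment> \<open>The floor assigns a grid point to the block that starts there; by the recursion
    for \<open>m\<close>, the block ending there yields the same value
    (\<open>mu_block\<close>).\<close>
  define mu where "mu = (\<lambda>t. \<phi> (nat \<lfloor>t / \<Delta>t\<rfloor>) t)"
  have AEX: "AE \<omega> in M. continuous_on {0..} (\<lambda>t. X t \<omega>) \<and>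
        (\<forall>i::nat. \<forall>t\<in>{real i * \<Delta>t .. real (Suc i) * \<Delta>t}.
           X t \<omega> = X (real i * \<Delta>t) \<omega> - \<kappa> *\<^sub>R integral {real i * \<Delta>t .. t} (\<lambda>r. X r \<omega> - c i)
             + \<nu> *\<^sub>R (B t \<omega> - B (real i * \<Delta>t) \<omega>))"
    using sol by (simp add: consensus_freezing_solution_def \<kappa>_def \<nu>_def c_def)
  have m0: "m 0 = x0" and mSuc: "m (Suc i) = c i + exp (- \<kappa> * \<Delta>t) *\<^sub>R (m i - c i)" for i
    by (simp_all add: m_def)
  have \<phi>0: "\<phi> i (real i * \<Delta>t) = m i" for i by (simp add: \<phi>_def)
  have mu_lt: "mu t = \<phi> i t" if "real i * \<Delta>t \<le> t" "t < real (Suc i) * \<Delta>t" for i t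
  proof -
    have "\<lfloor>t / \<Delta>t\<rfloor> = int i" using that pos by (intro floor_unique) (auto simp: field_simps)
    then show ?thesis by (simp add: mu_def)
  qed
  have mu_grid: "mu (real i * \<Delta>t) = m i" for i
    using mu_lt[of i "real i * \<Delta>t"] pos \<phi>0 by simp
  have mu_block: "mu t = \<phi> i t" if "t \<in> {real i * \<Delta>t..real (Suc i) * \<Delta>t}" for i t
  proof (cases "t = real (Suc i) * \<Delta>t")
    case True
    have "\<phi> i (real (Suc i) * \<Delta>t) = m (Suc i)" by (simp add: \<phi>_def mSuc algebra_simps)
    then show ?thesis using mu_grid[of "Suc i"] True by simp
  next
    case False then show ?thesis using that by (intro mu_lt) auto
  qed
  have mu_cont: "continuous_on {0..real n * \<Delta>t} mu" for n
  proof (rule continuous_on_Icc_blocks[OF pos(3)])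
    fix i
    have "continuous_on {real i * \<Delta>t..real (Suc i) * \<Delta>t} (\<phi> i)"
      unfolding \<phi>_def by (intro continuous_intros)
    then show "continuous_on {real i * \<Delta>t..real (Suc i) * \<Delta>t} mu"
      by (rule continuous_on_eq) (simp add: mu_block[of _ i])
  qed
  have mu0: "mu 0 = x0" using mu_grid[of 0] m0 by simp
  have law: "law M X t = gaussian (mu t) \<sigma>" if t: "t > 0" for t
  proof -
    define Y where "Y = (\<lambda>r \<omega>. X r \<omega> - mu r)"
    have [measurable]: "X 0 \<in> borel_measurable M" "X t \<in> borel_measurable M" using Xm t by auto
    have AEY: "AE \<omega> in M. (\<lambda>n. exp (- \<kappa> * t) *\<^sub>R Y 0 \<omega> +
      (\<Sum>j<n. exp (- \<kappa> * (t - real j * t / real n)) *\<^sub>R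
         (\<nu> *\<^sub>R B (real (Suc j) * t / real n) \<omega> - \<nu> *\<^sub>R B (real j * t / real n) \<omega>))) \<longlonglongrightarrow> Y t \<omega>"
      using AEX
    proof eventually_elim
      case (elim \<omega>)
      have Yc: "continuous_on {0..real n * \<Delta>t} (\<lambda>r. Y r \<omega>)" for n
        unfolding Y_def using elim mu_cont
        by (intro continuous_on_diff) (auto elim: continuous_on_subset)
      \<comment> \<open>The constant \<open>c i\<close> cancels between \<open>X\<close> and
        \<open>mu\<close>. The integral equation of \<open>mu\<close> is verified by integrating the
        exponential \<open>E\<close> explicitly.\<close>
      have Yeq: "Y b \<omega> = Y (real i * \<Delta>t) \<omega> - \<kappa> *\<^sub>R integral {real i * \<Delta>t..b} (\<lambda>r. Y r \<omega>)
          + (\<nu> *\<^sub>R B b \<omega> - \<nu> *\<^sub>R B (real i * \<Delta>t) \<omega>)"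
        if b: "b \<in> {real i * \<Delta>t..real (Suc i) * \<Delta>t}" for i b
      proof -
        define d where "d = m i - c i"
        define E where "E = (\<lambda>r. exp (- \<kappa> * (r - real i * \<Delta>t)))"
        have i0: "real i * \<Delta>t \<ge> 0" using pos by simp
        have "((\<lambda>r. E r) has_integral (- E b / \<kappa> - - E (real i * \<Delta>t) / \<kappa>)) {real i * \<Delta>t..b}"
          unfolding E_def using b \<kappa>
          by (intro fundamental_theorem_of_calculus)
             (auto intro!: derivative_eq_intros simp flip: has_real_derivative_iff_has_vector_derivative)
        then have "((\<lambda>r. E r *\<^sub>R d) has_integral (- E b / \<kappa> - - E (real i * \<Delta>t) / \<kappa>) *\<^sub>R d) {real i * \<Delta>t..b}"
          by (rule has_integral_scaleR_left)
        moreover have "(\<lambda>r. X r \<omega> - c i) integrable_on {real i * \<Delta>t..b}"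
          using elim i0
          by (intro integrable_continuous_interval continuous_on_diff continuous_on_const)
             (auto elim: continuous_on_subset)
        ultimately have "((\<lambda>r. (X r \<omega> - c i) - E r *\<^sub>R d) has_integral
            (integral {real i * \<Delta>t..b} (\<lambda>r. X r \<omega> - c i) - (- E b / \<kappa> - - E (real i * \<Delta>t) / \<kappa>) *\<^sub>R d))
            {real i * \<Delta>t..b}"
          by (intro has_integral_diff integrable_integral)
        then have "integral {real i * \<Delta>t..b} (\<lambda>r. (X r \<omega> - c i) - E r *\<^sub>R d) =
            integral {real i * \<Delta>t..b} (\<lambda>r. X r \<omega> - c i) - (- E b / \<kappa> - - E (real i * \<Delta>t) / \<kappa>) *\<^sub>R d"
          by (rule integral_unique)
        moreover have "integral {real i * \<Delta>t..b} (\<lambda>r. Y r \<omega>)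
            = integral {real i * \<Delta>t..b} (\<lambda>r. (X r \<omega> - c i) - E r *\<^sub>R d)"
          using b by (intro Henstock_Kurzweil_Integration.integral_cong)
            (auto simp: Y_def mu_block[of _ i] \<phi>_def E_def d_def)
        ultimately have YI: "\<kappa> *\<^sub>R integral {real i * \<Delta>t..b} (\<lambda>r. Y r \<omega>)
            = \<kappa> *\<^sub>R integral {real i * \<Delta>t..b} (\<lambda>r. X r \<omega> - c i) - (1 - E b) *\<^sub>R d"
          using \<kappa> by (simp add: scaleR_diff_right E_def right_diff_distrib)
        have Xb: "X b \<omega> = X (real i * \<Delta>t) \<omega> - \<kappa> *\<^sub>R integral {real i * \<Delta>t .. b} (\<lambda>r. X r \<omega> - c i)
             + \<nu> *\<^sub>R (B b \<omega> - B (real i * \<Delta>t) \<omega>)"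
          using elim b by blast
        have mub: "mu b = c i + E b *\<^sub>R d" using mu_block[OF b] by (simp add: \<phi>_def E_def d_def)
        have mui: "mu (real i * \<Delta>t) = c i + d" using mu_grid[of i] by (simp add: d_def)
        show ?thesis
          unfolding YI unfolding Y_def Xb mub mui by (simp add: algebra_simps)
      qed
      obtain n where "t / \<Delta>t \<le> real n" using real_arch_simple by blast
      then have n: "t \<le> real n * \<Delta>t" using pos by (simp add: field_simps)
      show ?case
      proof (rule exponential_Euler_limit[where Y="\<lambda>r. Y r \<omega>" and N="\<lambda>r. \<nu> *\<^sub>R B r \<omega>", OF t \<kappa>])
        show "continuous_on {0..t} (\<lambda>r. Y r \<omega>)"
          by (rule continuous_on_subset[OF Yc[of n]]) (use n in auto)
        fix b assume "b \<in> {0..t}"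
        then show "Y b \<omega> = Y 0 \<omega> - \<kappa> *\<^sub>R integral {0..b} (\<lambda>r. Y r \<omega>) + (\<nu> *\<^sub>R B b \<omega> - \<nu> *\<^sub>R B 0 \<omega>)"
          using integral_equation_blocks[where Y="\<lambda>r. Y r \<omega>" and N="\<lambda>r. \<nu> *\<^sub>R B r \<omega>",
              OF pos(3) Yc Yeq, of b n] n by simp
      qed
    qed
    have "distr M borel (Y 0) = distr (law M X 0) borel (\<lambda>x. - x0 + 1 *\<^sub>R x)"
      by (subst distr_distr) (auto simp: comp_def Y_def mu0)
    then have lawY0: "distr M borel (Y 0) = gaussian 0 \<sigma>"
      using distr_gaussian_affine[OF \<sigma>, of 1 x0 "- x0"] law0 by simp
    have indY: "indep_var borel (Y 0) borel (\<lambda>\<omega>. F (\<lambda>t\<in>{0..}. B t \<omega>))"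
      if "F \<in> measurable (PiM {0..} (\<lambda>_. borel)) borel" for F :: "(real \<Rightarrow> 'a) \<Rightarrow> 'a"
      unfolding Y_def mu0
      by (rule indep_var_compose_vimage_algebras[OF _ _ _ that ind, where f="\<lambda>x. x - x0"])
         (auto intro!: measurable_restrict Bm)
    have [measurable]: "Y 0 \<in> borel_measurable M" "Y t \<in> borel_measurable M"
      unfolding Y_def by measurable
    have lawYt: "distr M borel (Y t) = gaussian 0 \<sigma>"
      by (rule law_of_OU[OF BM _ _ lawY0 indY \<kappa> \<nu> \<sigma> t var AEY]) auto
    have "law M X t = distr (distr M borel (Y t)) borel (\<lambda>y. mu t + 1 *\<^sub>R y)"
      by (subst distr_distr) (auto simp: comp_def Y_def)
    then show ?thesis
      using distr_gaussian_affine[OF \<sigma>, of 1 0 "mu t"] lawYt by simp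
  qed
  \<comment> \<open>Time 0 is separate because the Euler limit requires a positive time.\<close>
  have law': "law M X t = gaussian (mu t) \<sigma>" if "t \<ge> 0" for t
    using law[of t] law0 mu0 that by (cases "t = 0") auto
  show ?thesis
  proof (rule that[OF mu0 law'])
    fix i t assume t: "t \<in> {real i * \<Delta>t..real (Suc i) * \<Delta>t}"
    have "c i = consensus_point f \<alpha> (gaussian (mu (real i * \<Delta>t)) \<sigma>)"
      unfolding c_def using pos by (subst law') auto
    then show "mu t = consensus_point f \<alpha> (gaussian (mu (real i * \<Delta>t)) \<sigma>) + exp (- (s * lam) * (t - real i * \<Delta>t)) *\<^sub>R
         (mu (real i * \<Delta>t) - consensus_point f \<alpha> (gaussian (mu (real i * \<Delta>t)) \<sigma>))"
      using mu_block[OF t] mu_grid[of i] by (simp add: \<phi>_def \<kappa>_def)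
  qed
qed

section \<open>Deterministic iterations in a ball, and the main estimate\<close>

lemma norm_interpolation_le:
  fixes x y :: "'a::real_normed_vector"
  assumes "norm x \<le> R" "norm y \<le> R" "0 \<le> q" "q \<le> 1"
  shows "norm (x + q *\<^sub>R (y - x)) \<le> R"
proof -
  have "x + q *\<^sub>R (y - x) = (1 - q) *\<^sub>R x + q *\<^sub>R y" by (simp add: algebra_simps)
  then have "norm (x + q *\<^sub>R (y - x)) \<le> (1 - q) * norm x + q * norm y"
    using norm_triangle_ineq[of "(1 - q) *\<^sub>R x" "q *\<^sub>R y"] assms by simp
  also have "\<dots> \<le> (1 - q) * R + q * R" using assms by (intro add_mono mult_left_mono) auto
  finally show ?thesis by (simp add: algebra_simps)
qed

text \<open>Invariance of the ball is proved together with the error bound, since both properties of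
  \<open>T\<close> are available only inside it. The common starting point makes the initial error
  0.\<close>

lemma relaxed_contraction_error:
  fixes T :: "'a::real_normed_vector \<Rightarrow> 'a"
  assumes T: "\<And>x. norm x \<le> R \<Longrightarrow> norm (T x) \<le> R"
    and contr: "\<And>x y. norm x \<le> R \<Longrightarrow> norm y \<le> R \<Longrightarrow> norm (T x - T y) \<le> norm (x - y) / 2"
    and q: "0 \<le> q" "q \<le> 1" and x0: "norm (x 0) \<le> R" "y 0 = x 0"
    and x: "\<And>k. x (Suc k) = T (x k) + q *\<^sub>R (x k - T (x k))" and y: "\<And>k. y (Suc k) = T (y k)"
  shows "norm (x k) \<le> R \<and> norm (y k) \<le> R \<and> norm (x k - y k) \<le> 4 * R * q"
proof (induction k)
  case 0
  have "R \<ge> 0" using x0(1) norm_ge_zero[of "x 0"] by linarith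
  then show ?case using x0 q by simp
next
  case (Suc k)
  then have k: "norm (x k) \<le> R" "norm (y k) \<le> R" "norm (x k - y k) \<le> 4 * R * q" by auto
  have "x (Suc k) - y (Suc k) = (T (x k) - T (y k)) + q *\<^sub>R (x k - T (x k))"
    by (simp add: x y)
  then have "norm (x (Suc k) - y (Suc k)) \<le> norm (T (x k) - T (y k)) + q * norm (x k - T (x k))"
    using norm_triangle_ineq[of "T (x k) - T (y k)" "q *\<^sub>R (x k - T (x k))"] q by simp
  also have "\<dots> \<le> norm (x k - y k) / 2 + q * (2 * R)"
    using contr[OF k(1,2)] norm_triangle_ineq4[of "x k" "T (x k)"] k(1) T[OF k(1)] q(1)
    by (intro add_mono mult_left_mono) auto
  also have "\<dots> \<le> 4 * R * q" using k(3) by simp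
  finally show ?case
    using norm_interpolation_le[OF T[OF k(1)] k(1) q] T[OF k(2)] by (simp add: x y)
qed

text \<open>Within a block the mean is a convex combination of the grid value and its image under
  \<open>T\<close>, so convexity and invariance of the ball carry the bound from one grid point
  through the next block.\<close>

lemma freezing_mean_bounded:
  fixes mu :: "real \<Rightarrow> 'a::real_normed_vector"
  assumes "\<Delta> > 0" "\<kappa> > 0" and mu0: "norm (mu 0) \<le> R"
    and T: "\<And>x. norm x \<le> R \<Longrightarrow> norm (T x) \<le> R"
    and block: "\<And>i t. t \<in> {real i * \<Delta>..real (Suc i) * \<Delta>} \<Longrightarrow>
       mu t = T (mu (real i * \<Delta>)) + exp (- \<kappa> * (t - real i * \<Delta>)) *\<^sub>R (mu (real i * \<Delta>) - T (mu (real i * \<Delta>)))"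
    and t: "t \<ge> 0"
  shows "norm (mu t) \<le> R"
proof -
  have step: "norm (mu t) \<le> R" if "norm (mu (real i * \<Delta>)) \<le> R" "t \<in> {real i * \<Delta>..real (Suc i) * \<Delta>}" for i t
    unfolding block[OF that(2)]
    by (intro norm_interpolation_le T that(1)) (use that assms in auto)
  have grid: "norm (mu (real i * \<Delta>)) \<le> R" for i
  proof (induction i)
    case (Suc i) then show ?case by (rule step) (use assms in auto)
  qed (use mu0 in simp)
  define i where "i = nat \<lfloor>t / \<Delta>\<rfloor>"
  have "real i \<le> t / \<Delta>" "t / \<Delta> \<le> real (Suc i)" using t assms(1) by (auto simp: i_def) linarith
  then have "t \<in> {real i * \<Delta>..real (Suc i) * \<Delta>}" using assms(1) by (simp add: field_simps)
  then show ?thesis by (rule step[OF grid])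
qed

text \<open>The separate existence claim shows that admissible radii exist, so the second part,
  valid for each of them, is not vacuous in \<open>R\<close>. Uniformity in \<open>k\<close> lies in
  the quantifier order: \<open>\<alpha>1\<close>, and for given \<open>\<epsilon>\<close> the
  threshold for \<open>s\<close>, are fixed before the solution and \<open>k\<close>.\<close>

theorem theorem4p1:
  fixes f :: "'a::euclidean_space \<Rightarrow> real"
    and xstar x0 :: 'a
    and lam \<delta> \<Delta>t Lf cl cu Mf \<sigma> :: real
  assumes "lam > 0" and "\<delta> > 0" and "\<Delta>t > 0"
    and "continuous_on UNIV f"
    and min: "\<And>x. f xstar \<le> f x"
    and uniq: "\<And>x. f x = f xstar \<Longrightarrow> x = xstar"
    and "Lf > 0"
    and "\<And>x y. \<bar>f x - f y\<bar> \<le> Lf * (1 + norm x + norm y) * norm (x - y)"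
    and "cl > 0" and "cu > 0" and "Mf > 0"
    and "\<And>x. f x - f xstar \<le> cu * ((norm x)\<^sup>2 + 1)"
    and "\<And>x. norm x \<ge> Mf \<Longrightarrow> cl * (norm x)\<^sup>2 \<le> f x - f xstar"
    and sigma: "\<sigma> = \<delta> / sqrt (2 * lam)"
  shows "(\<exists>R>0. xstar \<in> ball 0 R \<and> uniform_mean_bound TYPE('w) f lam \<delta> \<Delta>t (gaussian x0 \<sigma>) R) \<and>
    (\<forall>R>0. xstar \<in> ball 0 R \<longrightarrow> uniform_mean_bound TYPE('w) f lam \<delta> \<Delta>t (gaussian x0 \<sigma>) R \<longrightarrow>
     (\<exists>\<alpha>1>0. \<forall>\<alpha>\<ge>\<alpha>1.
        (\<forall>s>0. \<forall>(M :: 'w measure) B X.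
           consensus_freezing_solution f lam \<delta> \<Delta>t \<alpha> s (gaussian x0 \<sigma>) M B X \<longrightarrow>
           (\<forall>k::nat.
              norm (mean (law M X (real k * \<Delta>t)) - consensus_hopping f \<alpha> \<sigma> x0 k)
                \<le> 4 * R * exp (- s * lam * \<Delta>t) \<and>
              wasserstein2 (law M X (real k * \<Delta>t)) (gaussian (consensus_hopping f \<alpha> \<sigma> x0 k) \<sigma>)
                \<le> ennreal (4 * R * exp (- s * lam * \<Delta>t)))) \<and>
        ((\<lambda>s. 4 * R * exp (- s * lam * \<Delta>t)) \<longlongrightarrow> 0) at_top \<and>
        (\<forall>\<epsilon>>0. \<forall>\<^sub>F s in at_top. \<forall>(M :: 'w measure) B X.
           consensus_freezing_solution f lam \<delta> \<Delta>t \<alpha> s (gaussian x0 \<sigma>) M B X \<longrightarrow>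
           (\<forall>k::nat.
              norm (mean (law M X (real k * \<Delta>t)) - consensus_hopping f \<alpha> \<sigma> x0 k) < \<epsilon> \<and>
              wasserstein2 (law M X (real k * \<Delta>t)) (gaussian (consensus_hopping f \<alpha> \<sigma> x0 k) \<sigma>)
                < ennreal \<epsilon>))))"
proof (intro conjI allI impI)
  have \<sigma>: "\<sigma> > 0" using assms(1,2) sigma by simp
  have sep: "\<forall>r>0. \<exists>c>0. \<forall>x. norm (x - xstar) \<ge> r \<longrightarrow> f xstar + c \<le> f x"
    using quadratic_growth_separation[of f xstar cl Mf] assms(4,9,11,13) min uniq by blast
  note contraction = consensus_point_contraction[OF \<sigma> assms(4) min sep]
  show "\<exists>R>0. xstar \<in> ball 0 R \<and> uniform_mean_bound TYPE('w) f lam \<delta> \<Delta>t (gaussian x0 \<sigma>) R"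
  proof (intro exI conjI)
    \<comment> \<open>\<open>norm x0\<close> accommodates the initial mean and the summand 1 the
      concentration radius used below, so that the ball is invariant.\<close>
    define R where "R = norm xstar + norm x0 + 1"
    show R: "R > 0" by (simp add: R_def add_nonneg_pos)
    show "xstar \<in> ball 0 R" by (simp add: R_def add_nonneg_pos)
    obtain \<alpha>1 where \<alpha>1: "\<alpha>1 > 0" "\<And>\<alpha> m. \<alpha> \<ge> \<alpha>1 \<Longrightarrow> norm m \<le> R \<Longrightarrow>
        norm (consensus_point f \<alpha> (gaussian m \<sigma>) - xstar) \<le> 1"
      using contraction[OF R, of 1] by auto
    show "uniform_mean_bound TYPE('w) f lam \<delta> \<Delta>t (gaussian x0 \<sigma>) R"
      unfolding uniform_mean_bound_def
    proof (intro exI[of _ \<alpha>1] conjI allI impI)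
      fix \<alpha> s :: real and M :: "'w measure" and B X and t :: real
      assume a: "\<alpha> \<ge> \<alpha>1" "s > 0" "t \<ge> 0"
        and sol: "consensus_freezing_solution f lam \<delta> \<Delta>t \<alpha> s (gaussian x0 \<sigma>) M B X"
      obtain mu where mu: "mu 0 = x0" "\<And>t. t \<ge> 0 \<Longrightarrow> law M X t = gaussian (mu t) \<sigma>"
        "\<And>i t. t \<in> {real i * \<Delta>t..real (Suc i) * \<Delta>t} \<Longrightarrow>
           mu t = consensus_point f \<alpha> (gaussian (mu (real i * \<Delta>t)) \<sigma>) + exp (- (s * lam) * (t - real i * \<Delta>t)) *\<^sub>R
             (mu (real i * \<Delta>t) - consensus_point f \<alpha> (gaussian (mu (real i * \<Delta>t)) \<sigma>))"
        by (rule consensus_freezing_law[OF assms(1-3) a(2) sigma sol]) (rule that)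
      have T: "norm (consensus_point f \<alpha> (gaussian m \<sigma>)) \<le> R" if "norm m \<le> R" for m
        using \<alpha>1(2)[OF a(1) that] norm_triangle_sub[of "consensus_point f \<alpha> (gaussian m \<sigma>)" xstar]
          norm_ge_zero[of x0] unfolding R_def by linarith
      have "norm (mu t) \<le> R"
        by (rule freezing_mean_bounded[where T="\<lambda>m. consensus_point f \<alpha> (gaussian m \<sigma>)" and \<kappa>="s * lam",
              OF assms(3) _ _ T mu(3) a(3)])
           (use a assms mu in \<open>auto simp: R_def\<close>)
      then show "norm (mean (law M X t)) \<le> R" using mu(2)[OF a(3)] by (simp add: mean_gaussian[OF \<sigma>])
    qed (use \<alpha>1 in auto)
  qed
  fix R :: real
  assume R: "R > 0" and xR: "xstar \<in> ball 0 R"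
    and bound: "uniform_mean_bound TYPE('w) f lam \<delta> \<Delta>t (gaussian x0 \<sigma>) R"
  obtain \<alpha>0 where \<alpha>0: "\<alpha>0 > 0" "\<forall>\<alpha>\<ge>\<alpha>0. \<forall>s>0. \<forall>(M :: 'w measure) B X.
      consensus_freezing_solution f lam \<delta> \<Delta>t \<alpha> s (gaussian x0 \<sigma>) M B X \<longrightarrow> (\<forall>t\<ge>0. norm (mean (law M X t)) \<le> R)"
    using bound[unfolded uniform_mean_bound_def] by (elim exE conjE) (rule that)
  \<comment> \<open>Membership in the open ball leaves this positive margin; as the concentration
    radius it makes the ball of the given \<open>R\<close> invariant.\<close>
  have "R - norm xstar > 0" using xR by simp
  from contraction[OF R this]
  obtain \<alpha>c where \<alpha>c: "\<alpha>c > 0"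
    "\<And>\<alpha> m. \<alpha> \<ge> \<alpha>c \<Longrightarrow> norm m \<le> R \<Longrightarrow> norm (consensus_point f \<alpha> (gaussian m \<sigma>) - xstar) \<le> R - norm xstar"
    "\<And>\<alpha> m n. \<alpha> \<ge> \<alpha>c \<Longrightarrow> norm m \<le> R \<Longrightarrow> norm n \<le> R \<Longrightarrow>
        norm (consensus_point f \<alpha> (gaussian m \<sigma>) - consensus_point f \<alpha> (gaussian n \<sigma>)) \<le> norm (m - n) / 2"
    by auto
  have lim: "((\<lambda>s. 4 * R * exp (- s * lam * \<Delta>t)) \<longlongrightarrow> 0) at_top"
  proof -
    have "filterlim (\<lambda>s. (lam * \<Delta>t) * s) at_top at_top"
      using assms(1,3) by (intro filterlim_tendsto_pos_mult_at_top[OF tendsto_const] filterlim_ident) auto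
    then have "((\<lambda>s. exp (- ((lam * \<Delta>t) * s))) \<longlongrightarrow> 0) at_top"
      by (intro filterlim_compose[OF exp_at_bot]) (simp add: filterlim_uminus_at_top[symmetric])
    from tendsto_mult_right_zero[OF this, of "4 * R"] show ?thesis by (simp add: ac_simps)
  qed
  have error: "norm (mean (law M X (real k * \<Delta>t)) - consensus_hopping f \<alpha> \<sigma> x0 k) \<le> 4 * R * exp (- s * lam * \<Delta>t)
      \<and> wasserstein2 (law M X (real k * \<Delta>t)) (gaussian (consensus_hopping f \<alpha> \<sigma> x0 k) \<sigma>)
          \<le> ennreal (4 * R * exp (- s * lam * \<Delta>t))"
    if \<alpha>: "\<alpha> \<ge> max \<alpha>0 \<alpha>c" and s: "s > 0"
      and sol: "consensus_freezing_solution f lam \<delta> \<Delta>t \<alpha> s (gaussian x0 \<sigma>) M B X"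
    for \<alpha> s k and M :: "'w measure" and B X
  proof -
    obtain mu where mu: "mu 0 = x0" "\<And>t. t \<ge> 0 \<Longrightarrow> law M X t = gaussian (mu t) \<sigma>"
      "\<And>i t. t \<in> {real i * \<Delta>t..real (Suc i) * \<Delta>t} \<Longrightarrow>
         mu t = consensus_point f \<alpha> (gaussian (mu (real i * \<Delta>t)) \<sigma>) + exp (- (s * lam) * (t - real i * \<Delta>t)) *\<^sub>R
           (mu (real i * \<Delta>t) - consensus_point f \<alpha> (gaussian (mu (real i * \<Delta>t)) \<sigma>))"
      by (rule consensus_freezing_law[OF assms(1-3) s sigma sol]) (rule that)
    \<comment> \<open>At time 0 the mean of the solution at hand is \<open>x0\<close>, so the
      assumed bound on the means itself supplies the estimate.\<close>
    have x0R: "norm x0 \<le> R"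
      using \<alpha>0(2)[rule_format, OF _ s sol, of 0] \<alpha> mu(2)[of 0] mu(1) mean_gaussian[OF \<sigma>, of x0] by simp
    have T: "norm (consensus_point f \<alpha> (gaussian m \<sigma>)) \<le> R" if "norm m \<le> R" for m
      using \<alpha>c(2)[OF _ that, of \<alpha>] \<alpha> norm_triangle_sub[of "consensus_point f \<alpha> (gaussian m \<sigma>)" xstar] by simp
    have step: "mu (real (Suc k) * \<Delta>t) = consensus_point f \<alpha> (gaussian (mu (real k * \<Delta>t)) \<sigma>) + exp (- s * lam * \<Delta>t) *\<^sub>R
           (mu (real k * \<Delta>t) - consensus_point f \<alpha> (gaussian (mu (real k * \<Delta>t)) \<sigma>))" for k
      using mu(3)[of "real (Suc k) * \<Delta>t" k] assms(3) by (simp add: algebra_simps)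
    have err: "norm (mu (real k * \<Delta>t) - consensus_hopping f \<alpha> \<sigma> x0 k) \<le> 4 * R * exp (- s * lam * \<Delta>t)"
      using relaxed_contraction_error[where T="\<lambda>m. consensus_point f \<alpha> (gaussian m \<sigma>)" and q="exp (- s * lam * \<Delta>t)"
          and x="\<lambda>k. mu (real k * \<Delta>t)" and y="consensus_hopping f \<alpha> \<sigma> x0" and k=k, OF T \<alpha>c(3) _ _ _ _ step]
        \<alpha> s assms(1,3) x0R mu(1) by simp
    have "law M X (real k * \<Delta>t) = gaussian (mu (real k * \<Delta>t)) \<sigma>"
      using mu(2)[of "real k * \<Delta>t"] assms(3) by simp
    then show ?thesis
      using err order_trans[OF wasserstein2_gaussian_shift[OF \<sigma>] ennreal_leI[OF err]]
      by (simp add: mean_gaussian[OF \<sigma>])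
  qed
  show "\<exists>\<alpha>1>0. \<forall>\<alpha>\<ge>\<alpha>1.
        (\<forall>s>0. \<forall>(M :: 'w measure) B X.
           consensus_freezing_solution f lam \<delta> \<Delta>t \<alpha> s (gaussian x0 \<sigma>) M B X \<longrightarrow>
           (\<forall>k::nat.
              norm (mean (law M X (real k * \<Delta>t)) - consensus_hopping f \<alpha> \<sigma> x0 k)
                \<le> 4 * R * exp (- s * lam * \<Delta>t) \<and>
              wasserstein2 (law M X (real k * \<Delta>t)) (gaussian (consensus_hopping f \<alpha> \<sigma> x0 k) \<sigma>)
                \<le> ennreal (4 * R * exp (- s * lam * \<Delta>t)))) \<and>
        ((\<lambda>s. 4 * R * exp (- s * lam * \<Delta>t)) \<longlongrightarrow> 0) at_top \<and>
        (\<forall>\<epsilon>>0. \<forall>\<^sub>F s in at_top. \<forall>(M :: 'w measure) B X.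
           consensus_freezing_solution f lam \<delta> \<Delta>t \<alpha> s (gaussian x0 \<sigma>) M B X \<longrightarrow>
           (\<forall>k::nat.
              norm (mean (law M X (real k * \<Delta>t)) - consensus_hopping f \<alpha> \<sigma> x0 k) < \<epsilon> \<and>
              wasserstein2 (law M X (real k * \<Delta>t)) (gaussian (consensus_hopping f \<alpha> \<sigma> x0 k) \<sigma>)
                < ennreal \<epsilon>))"
  proof (intro exI[of _ "max \<alpha>0 \<alpha>c"] conjI allI impI)
    \<comment> \<open>Beyond \<open>\<alpha>0\<close> the assumed mean bound is in force, beyond
      \<open>\<alpha>c\<close> invariance and contraction; both thresholds are chosen before
      \<open>s\<close>.\<close>
    show "max \<alpha>0 \<alpha>c > 0" using \<alpha>0(1) by simp
    fix \<alpha> assume \<alpha>: "\<alpha> \<ge> max \<alpha>0 \<alpha>c"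
    show "((\<lambda>s. 4 * R * exp (- s * lam * \<Delta>t)) \<longlongrightarrow> 0) at_top" by (rule lim)
    fix \<epsilon> :: real assume \<epsilon>: "\<epsilon> > 0"
    have "\<forall>\<^sub>F s in at_top. 4 * R * exp (- s * lam * \<Delta>t) < \<epsilon>"
      using order_tendstoD(2)[OF lim \<epsilon>] .
    then show "\<forall>\<^sub>F s in at_top. \<forall>(M :: 'w measure) B X.
           consensus_freezing_solution f lam \<delta> \<Delta>t \<alpha> s (gaussian x0 \<sigma>) M B X \<longrightarrow>
           (\<forall>k::nat.
              norm (mean (law M X (real k * \<Delta>t)) - consensus_hopping f \<alpha> \<sigma> x0 k) < \<epsilon> \<and>
              wasserstein2 (law M X (real k * \<Delta>t)) (gaussian (consensus_hopping f \<alpha> \<sigma> x0 k) \<sigma>)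
                < ennreal \<epsilon>)"
      using eventually_gt_at_top[of 0]
    proof eventually_elim
      case (elim s)
      have "ennreal (4 * R * exp (- s * lam * \<Delta>t)) < ennreal \<epsilon>"
        using elim(1) \<epsilon> by (intro ennreal_lessI)
      then show ?case using error[OF \<alpha> elim(2)] elim(1) by (meson le_less_trans)
    qed
  qed (use error in auto)
qed

end
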